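(* Let $\Omega\subset\mathbb{R}^2$ be a convex body with $0\in\operatorname{int}\Omega$, and let $u\in C(\Omega)$ be a concave function such that $u=0$ on $\partial\Omega$. Assume that $0<|\partial^+_u(\Omega)|<\infty$, so that the quotient below is defined. Then for every triangle $T\subset\mathbb{R}^2$, $$ \frac{\frac{4}{27}|\Omega|\,|\partial^+_u(\Omega)|-\left(\sup_\Omega u\right)^2}{\frac{4}{27}|\Omega|\,|\partial^+_u(\Omega)|}\;\geq\;\frac{\delta_{BM}(\Omega,T)-1}{\delta_{BM}(\Omega,T)+899}. $$
   Context: A convex body in $\mathbb{R}^N$ is a non-empty, convex, compact subset of $\mathbb{R}^N$ with non-empty interior. $|E|$ denotes the Lebesgue measure of $E$. A triangle means a non-degenerate (two-dimensional, closed, filled) triangle. For $y\in\operatorname{int}\Omega$ the superdifferential of $u$ at $y$ is $$\partial^+_u(y)=\{p\in\mathbb{R}^N : u(x)\le u(y)+p\cdot(x-y)\ \ \forall x\in\Omega\},$$ and $\partial^+_u(\Omega)=\bigcup_{y\in\operatorname{int}\Omega}\partial^+_u(y)$ (only interior points $y$ are used). For convex bodies $K,L\subset\mathbb{R}^N$ the Banach-Mazur distance is $$\delta_{BM}(K,L)=\inf\{t\ge 1 : \text{there exist an invertible affine map } A:\mathbb{R}^N\to\mathbb{R}^N \text{ and } x\in\mathbb{R}^N \text{ with } L\subset A(K)\subset tL+x\}.$$ *)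

theory Defs
  imports "HOL-Analysis.Analysis"
begin

definition convex_body :: "'a::euclidean_space set \<Rightarrow> bool" where
  "convex_body K \<longleftrightarrow> K \<noteq> {} \<and> convex K \<and> compact K \<and> interior K \<noteq> {}"

text \<open>
  The function \<open>u\<close> is total in HOL, but only its values on \<open>\<Omega>\<close> matter. The superdifferential is
  meant for \<open>y\<close> in the interior of \<open>\<Omega>\<close>.
\<close>

definition superdifferential ::
    "'a::euclidean_space set \<Rightarrow> ('a \<Rightarrow> real) \<Rightarrow> 'a \<Rightarrow> 'a set" where
  "superdifferential \<Omega> u y = {p. \<forall>x\<in>\<Omega>. u x \<le> u y + p \<bullet> (x - y)}"

definition superdifferential_image ::
    "'a::euclidean_space set \<Rightarrow> ('a \<Rightarrow> real) \<Rightarrow> 'a set" where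
  "superdifferential_image \<Omega> u = (\<Union>y\<in>interior \<Omega>. superdifferential \<Omega> u y)"

definition invertible_affine_map :: "('a::real_vector \<Rightarrow> 'a) \<Rightarrow> bool" where
  "invertible_affine_map A \<longleftrightarrow> (\<exists>f b. linear f \<and> bij f \<and> A = (\<lambda>z. f z + b))"

text \<open>
  For convex bodies the set below is non-empty and bounded below by 1, so the conditionally complete
  infimum on the reals is the genuine infimum.
\<close>

definition banach_mazur_distance ::
    "'a::euclidean_space set \<Rightarrow> 'a set \<Rightarrow> real" where
  "banach_mazur_distance K L =
     Inf {t. t \<ge> 1 \<and> (\<exists>A x. invertible_affine_map A \<and>
                L \<subseteq> A ` K \<and> A ` K \<subseteq> (\<lambda>z. t *\<^sub>R z + x) ` L)}"

end

theory Submission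
  imports Defs
begin

text \<open>
  Let \<open>u\<close> have its maximum \<open>h > 0\<close> at \<open>x\<^sub>0\<close>. Comparison with the cone over \<open>\<Omega>\<close> with apex \<open>(x\<^sub>0, h)\<close> shows
  that \<open>\<partial>\<^sup>+\<^sub>u(\<Omega>)\<close> contains \<open>- h\<close> times the polar body of \<open>K = \<Omega> - x\<^sub>0\<close>, so the claim follows from a stable form
  of the planar Mahler inequality \<open>4 |K| |K\<degree>| \<ge> 27\<close> for an arbitrary interior origin.

  For the latter, take a triangle \<open>abc\<close> of largest area inscribed in \<open>K\<close>. Its vertices are touched by the
  sides of the anticomplementary triangle, and the three side normals split \<open>K\<degree>\<close> into three sectors, each paired
  with the part of \<open>K\<close> beyond one side of \<open>abc\<close>. The support line at the point of \<open>K\<close> farthest from that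
  side bounds the product of the areas of the paired pieces below by
  \<open>1 / (1 - l\<^sub>j) + 1 / (1 - l\<^sub>k)\<close> up to a factor, where \<open>l\<close> are the barycentric coordinates of the
  origin, and the three products combine by \<open>27 \<mu> a (1 - \<mu> - a) \<le> 1\<close>. If \<open>K\<close> extends beyond the
  sides by fractions \<open>e\<^sub>i \<in> [0, 1]\<close> of the altitudes, a second support line in each sector
  gains a term proportional to \<open>e\<^sub>i (1 - e\<^sub>i)\<close>. Hence near equality either all \<open>e\<^sub>i\<close> are small and \<open>K\<close> is
  close to \<open>abc\<close>, or all are near \<open>1\<close> and \<open>K\<close> is close to the anticomplementary triangle.
\<close>

section \<open>Determinants, wedges and polar bodies\<close>

text \<open>The sign \<open>s = \<plusminus> 1\<close> lets one argument serve both orientations of a triangle.\<close>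

definition det2 :: "real \<Rightarrow> real ^ 2 \<Rightarrow> real ^ 2 \<Rightarrow> real" where
  "det2 s x y = s * (x $ 1 * y $ 2 - x $ 2 * y $ 1)"

text \<open>The vector that represents the functional \<open>\<lambda>x. det2 s x z\<close> under
  the inner product. It turns a side of a triangle into a normal direction, where the polar body
  lives.\<close>

definition quarter_turn :: "real \<Rightarrow> real ^ 2 \<Rightarrow> real ^ 2" where
  "quarter_turn s z = vector [s * z $ 2, - (s * z $ 1)]"

text \<open>For \<open>0 < det2 s p q\<close> this is the cone spanned by \<open>p\<close> and
  \<open>q\<close>. Written with two half planes, it is visibly convex and closed.\<close>

definition wedge :: "real \<Rightarrow> real ^ 2 \<Rightarrow> real ^ 2 \<Rightarrow> (real ^ 2) set" where
  "wedge s p q = {z. 0 \<le> det2 s p z \<and> 0 \<le> det2 s z q}"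

definition polar_body :: "'a::real_inner set \<Rightarrow> 'a set" where
  "polar_body K = {p. \<forall>x\<in>K. p \<bullet> x \<le> 1}"

lemma inner_quarter_turn: "quarter_turn s z \<bullet> x = det2 s x z"
  by (simp add: quarter_turn_def det2_def inner_vec_def sum_2 algebra_simps)

lemma quarter_turn_eq_0: "s \<noteq> 0 \<Longrightarrow> quarter_turn s z = 0 \<longleftrightarrow> z = 0"
  by (auto simp: quarter_turn_def vec_eq_iff forall_2)

lemma det2_quarter_turn:
  "s\<^sup>2 = 1 \<Longrightarrow> det2 s (quarter_turn s z) (quarter_turn s w) = det2 s z w"
  unfolding quarter_turn_def det2_def power2_eq_square vector_2 by algebra

lemma det2_scaleR:
  "det2 s (c *\<^sub>R x) y = c * det2 s x y" "det2 s x (c *\<^sub>R y) = c * det2 s x y"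
  by (simp_all add: det2_def algebra_simps)

lemma det2_zero [simp]: "det2 s 0 y = 0" "det2 s x 0 = 0" "det2 s x x = 0"
  by (simp_all add: det2_def)

lemma det2_add: "det2 s (x + y) z = det2 s x z + det2 s y z" "det2 s x (y + z) = det2 s x y + det2 s x z"
  by (simp_all add: det2_def algebra_simps)

lemma det2_diff: "det2 s (x - y) z = det2 s x z - det2 s y z" "det2 s x (y - z) = det2 s x y - det2 s x z"
  by (simp_all add: det2_def algebra_simps)

lemma det2_commute: "det2 s y x = - det2 s x y"
  by (simp add: det2_def algebra_simps)

lemma det2_uminus_sign: "det2 (- s) x y = det2 s y x"
  by (simp add: det2_def algebra_simps)

lemma wedge_uminus_sign: "wedge (- s) p q = wedge s q p"
  by (auto simp: wedge_def det2_uminus_sign)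

lemma continuous_on_det2 [continuous_intros]:
  assumes "continuous_on S f" "continuous_on S g"
  shows "continuous_on S (\<lambda>x. det2 s (f x) (g x))"
  unfolding det2_def by (intro continuous_intros assms)

lemma det2_halfplane: "{z. c \<le> det2 s z w} = {z. quarter_turn s w \<bullet> z \<ge> c}"
  by (simp add: inner_quarter_turn)

lemma convex_det2_halfplane: "convex {z. c \<le> det2 s z w}"
  unfolding det2_halfplane by (rule convex_halfspace_ge)

lemma closed_det2_halfplane: "closed {z. c \<le> det2 s z w}"
  unfolding det2_halfplane by (rule closed_halfspace_ge)

lemma wedge_Int: "wedge s p q = {z. 0 \<le> det2 s z (- p)} \<inter> {z. 0 \<le> det2 s z q}"
  by (auto simp: wedge_def det2_def algebra_simps)

lemma convex_wedge: "convex (wedge s p q)"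
  unfolding wedge_Int by (intro convex_Int convex_det2_halfplane)

lemma closed_wedge: "closed (wedge s p q)"
  unfolding wedge_Int by (intro closed_Int closed_det2_halfplane)

lemma negligible_det2_line:
  assumes "s \<noteq> 0" "w \<noteq> 0"
  shows "negligible {z. det2 s z w = c}"
proof -
  have "{z. det2 s z w = c} = {z. quarter_turn s w \<bullet> z = c}"
    by (simp add: inner_quarter_turn)
  with negligible_hyperplane[of "quarter_turn s w" c] assms show ?thesis
    by (simp add: quarter_turn_eq_0)
qed

section \<open>Areas from below: inscribed triangles and essentially disjoint pieces\<close>

lemma measure_triangle_le:
  fixes S :: "(real ^ 2) set"
  assumes "convex S" "compact S" "s\<^sup>2 = 1" "p \<in> S" "q \<in> S" "r \<in> S"
  shows "det2 s (q - p) (r - p) / 2 \<le> measure lebesgue S"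
proof -
  have compact: "compact (convex hull {p, q, r})"
    by (simp add: finite_imp_compact_convex_hull)
  have s: "s = 1 \<or> s = -1"
    using assms(3) by (simp add: power2_eq_1_iff)
  have "det2 s (q - p) (r - p) / 2 \<le> measure lborel (convex hull {p, q, r})"
  proof -
    let ?X = "(r $ 1 - p $ 1) * (q $ 2 - p $ 2) - (q $ 1 - p $ 1) * (r $ 2 - p $ 2)"
    have "det2 s (q - p) (r - p) = - (s * ?X)"
      by (simp add: det2_def algebra_simps)
    also have "\<dots> \<le> \<bar>?X\<bar>"
      using s by auto
    finally show ?thesis
      unfolding content_triangle by simp
  qed
  also have "\<dots> = measure lebesgue (convex hull {p, q, r})"
    using compact by (simp add: borel_compact)
  also have "\<dots> \<le> measure lebesgue S"
    using assms compact
    by (intro measure_mono_fmeasurable hull_minimal) (auto simp: lmeasurable_compact fmeasurableD)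
  finally show ?thesis .
qed

lemma measure_split_le:
  fixes S :: "(real ^ 2) set"
  assumes "compact S" "compact U" "compact V" "U \<subseteq> S" "V \<subseteq> S" "negligible (U \<inter> V)"
  shows "measure lebesgue U + measure lebesgue V \<le> measure lebesgue S"
proof -
  have "measure lebesgue U + measure lebesgue V = measure lebesgue (U \<union> V)"
    using assms measure_Un3[of U lebesgue V]
    by (simp add: lmeasurable_compact negligible_imp_measure0)
  also have "\<dots> \<le> measure lebesgue S"
    using assms by (intro measure_mono_fmeasurable) (auto simp: lmeasurable_compact fmeasurableD)
  finally show ?thesis .
qed

lemma wedge_subset_left:
  assumes "0 < det2 s p v" "0 \<le> det2 s v q" "0 \<le> det2 s p q"
  shows "wedge s p v \<subseteq> wedge s p q"
proof
  fix z assume z: "z \<in> wedge s p v"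
  \<comment> \<open>The Grassmann-Pluecker relation for \<open>p\<close>, \<open>v\<close>,
    \<open>z\<close>, \<open>q\<close>; its first factor is positive.\<close>
  have "det2 s p v * det2 s z q = det2 s z v * det2 s p q + det2 s p z * det2 s v q"
    by (simp add: det2_def algebra_simps)
  also have "\<dots> \<ge> 0"
    using z assms by (simp add: wedge_def)
  finally show "z \<in> wedge s p q"
    using z assms by (simp add: wedge_def zero_le_mult_iff)
qed

text \<open>Reversing the orientation exchanges the two ends of a wedge.\<close>

lemma wedge_subset_right:
  assumes "0 \<le> det2 s p v" "0 < det2 s v q" "0 \<le> det2 s p q"
  shows "wedge s v q \<subseteq> wedge s p q"
  using wedge_subset_left[of "- s" q v p] assms by (simp add: wedge_uminus_sign det2_uminus_sign)

lemma measure_wedge_split: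
  assumes "compact P" "s \<noteq> 0" "0 < det2 s p v" "0 < det2 s v q" "0 \<le> det2 s p q"
  shows "measure lebesgue (P \<inter> wedge s p v) + measure lebesgue (P \<inter> wedge s v q)
           \<le> measure lebesgue (P \<inter> wedge s p q)"
proof (rule measure_split_le)
  have "v \<noteq> 0" using assms(3) by auto
  moreover have "P \<inter> wedge s p v \<inter> (P \<inter> wedge s v q) \<subseteq> {z. det2 s z v = 0}"
    using det2_commute[of s v] by (auto simp: wedge_def)
  ultimately show "negligible (P \<inter> wedge s p v \<inter> (P \<inter> wedge s v q))"
    using negligible_det2_line[OF assms(2)] negligible_subset by blast
qed (use assms wedge_subset_left[of s p v q] wedge_subset_right[of s p v q] closed_wedge in
     \<open>auto intro!: compact_Int_closed\<close>)

lemma measure_wedge_ge: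
  assumes "convex P" "compact P" "s\<^sup>2 = 1" "0 \<in> P" "p \<in> P" "q \<in> P" "0 \<le> det2 s p q"
  shows "det2 s p q / 2 \<le> measure lebesgue (P \<inter> wedge s p q)"
proof -
  have "det2 s (p - 0) (q - 0) / 2 \<le> measure lebesgue (P \<inter> wedge s p q)"
    using assms
    by (intro measure_triangle_le) (auto simp: wedge_def convex_wedge[unfolded wedge_def]
        closed_wedge[unfolded wedge_def] intro!: convex_Int compact_Int_closed)
  then show ?thesis by simp
qed

section \<open>Polar bodies and the points dual to support lines\<close>

lemma zero_in_polar_body: "0 \<in> polar_body K"
  by (simp add: polar_body_def)

lemma polar_body_Inter: "polar_body K = (\<Inter>x\<in>K. {p. x \<bullet> p \<le> 1})"
  by (auto simp: polar_body_def inner_commute)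

lemma convex_polar_body: "convex (polar_body K)"
  unfolding polar_body_Inter by (intro convex_INT convex_halfspace_le)

lemma compact_polar_body:
  fixes K :: "'a::euclidean_space set"
  assumes "0 \<in> interior K"
  shows "compact (polar_body K)"
proof -
  obtain r where r: "r > 0" "cball 0 r \<subseteq> K"
    using assms mem_interior_cball by blast
  have "norm p \<le> 1 / r" if p: "p \<in> polar_body K" for p
  proof (cases "p = 0")
    case False
    then have "(r / norm p) *\<^sub>R p \<in> K"
      using r by (intro subsetD[OF r(2)]) simp
    with p have "p \<bullet> ((r / norm p) *\<^sub>R p) \<le> 1"
      by (auto simp: polar_body_def)
    then show ?thesis
      using False r by (simp add: dot_square_norm power2_eq_square field_simps)
  qed (use r in simp)
  then have "bounded (polar_body K)"
    by (auto simp: bounded_iff)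
  moreover have "closed (polar_body K)"
    unfolding polar_body_Inter by (intro closed_INT ballI closed_halfspace_le)
  ultimately show ?thesis
    by (simp add: compact_eq_bounded_closed)
qed

lemma det2_pos_interior:
  assumes "0 \<in> interior K" "z \<noteq> 0" "s \<noteq> 0"
  obtains x where "x \<in> K" "0 < det2 s x z"
proof -
  obtain r where r: "r > 0" "cball 0 r \<subseteq> K"
    using assms mem_interior_cball by blast
  define x where "x = (r / norm (quarter_turn s z)) *\<^sub>R quarter_turn s z"
  have nz: "quarter_turn s z \<noteq> 0"
    using assms by (simp add: quarter_turn_eq_0)
  have "x \<in> K"
    unfolding x_def using r nz by (intro subsetD[OF r(2)]) simp
  moreover have "0 < det2 s x z"
    unfolding inner_quarter_turn[symmetric] x_def using nz r by simp
  ultimately show ?thesis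
    using that by blast
qed

text \<open>Duality: a half plane \<open>det2 s x z \<le> N\<close> containing \<open>K\<close> is a
  point of the polar body. All polar vertices used for area bounds arise in this way.\<close>

lemma quarter_turn_in_polar_body:
  assumes "\<And>x. x \<in> K \<Longrightarrow> det2 s x z \<le> N" "0 < N"
  shows "(1 / N) *\<^sub>R quarter_turn s z \<in> polar_body K"
  using assms by (auto simp: polar_body_def inner_quarter_turn field_simps)

section \<open>One sector\<close>

text \<open>The barycentric coordinate of \<open>z\<close> at the vertex \<open>a\<close> of the
  triangle \<open>a b c\<close>. Cycling \<open>a\<close>, \<open>b\<close>, \<open>c\<close> gives
  the other two coordinates and leaves the denominator unchanged.\<close>

definition barycoord :: "real \<Rightarrow> real ^ 2 \<Rightarrow> real ^ 2 \<Rightarrow> real ^ 2 \<Rightarrow> real ^ 2 \<Rightarrow> real" where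
  "barycoord s a b c z = det2 s (b - z) (c - z) / det2 s (b - a) (c - a)"

lemma barycoord_uminus_sign: "barycoord (- s) a c b = barycoord s a b c"
  by (auto simp: barycoord_def det2_uminus_sign fun_eq_iff)

lemma det2_cyclic:
  "det2 s (c - b) (a - b) = det2 s (b - a) (c - a)"
  "det2 s (a - c) (b - c) = det2 s (b - a) (c - a)"
  by (simp_all add: det2_def algebra_simps)

lemma barycoord_mult:
  assumes "det2 s (b - a) (c - a) \<noteq> 0"
  shows "det2 s (b - a) (c - a) * barycoord s a b c z = det2 s (b - z) (c - z)"
    and "det2 s (b - a) (c - a) * barycoord s b c a z = det2 s (c - z) (a - z)"
    and "det2 s (b - a) (c - a) * barycoord s c a b z = det2 s (a - z) (b - z)"
  using assms det2_cyclic[where s = s and a = a and b = b and c = c] by (simp_all add: barycoord_def)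

lemma barycoord_sum:
  assumes "det2 s (b - a) (c - a) \<noteq> 0"
  shows "barycoord s a b c z + barycoord s b c a z + barycoord s c a b z = 1"
proof -
  have "det2 s (b - a) (c - a) * (barycoord s a b c z + barycoord s b c a z + barycoord s c a b z)
      = det2 s (b - a) (c - a)"
    unfolding distrib_left barycoord_mult[OF assms] by (simp add: det2_def algebra_simps)
  then show ?thesis
    using assms by simp
qed

text \<open>The part of the configuration belonging to the side \<open>b c\<close>. By
  \<open>b_max\<close> and \<open>c_max\<close>, \<open>K\<close> stays within the lines through
  \<open>b\<close> and \<open>c\<close> parallel to the sides opposite to them; \<open>x\<close> is
  a point of \<open>K\<close> farthest beyond \<open>b c\<close>. The sign \<open>s\<close> is kept
  free so that \<open>b\<close> and \<open>c\<close> can be exchanged later.\<close>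

locale sector =
  fixes K :: "(real ^ 2) set" and s :: real and a b c x :: "real ^ 2"
  assumes convex_K: "convex K" and compact_K: "compact K" and zero_K: "0 \<in> interior K"
    and s2: "s\<^sup>2 = 1"
    and vertices: "a \<in> K" "b \<in> K" "c \<in> K" and x_in: "x \<in> K"
    and area_pos: "0 < det2 s (b - a) (c - a)"
    and b_max: "\<And>z. z \<in> K \<Longrightarrow> det2 s z (c - a) \<le> det2 s b (c - a)"
    and c_max: "\<And>z. z \<in> K \<Longrightarrow> det2 s z (a - b) \<le> det2 s c (a - b)"
    and x_max: "\<And>z. z \<in> K \<Longrightarrow> det2 s z (c - b) \<le> det2 s x (c - b)"
begin

text \<open>\<open>D\<close> is twice the area of the triangle, \<open>la\<close>,
  \<open>lb\<close>, \<open>lc\<close> locate the origin, and \<open>eta\<close> is the reach of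
  \<open>K\<close> beyond \<open>b c\<close> in units of the altitude from \<open>a\<close>. The
  points \<open>bb\<close> and \<open>cc\<close> are dual to the support lines at \<open>b\<close>
  and \<open>c\<close>.\<close>

abbreviation "D \<equiv> det2 s (b - a) (c - a)"
abbreviation "la \<equiv> barycoord s a b c 0"
abbreviation "lb \<equiv> barycoord s b c a 0"
abbreviation "lc \<equiv> barycoord s c a b 0"
abbreviation "eta \<equiv> - barycoord s a b c x"
abbreviation "t \<equiv> barycoord s b c a x"
abbreviation "cap \<equiv> K \<inter> {z. det2 s b (c - b) \<le> det2 s z (c - b)}"
abbreviation "P \<equiv> polar_body K"
abbreviation "bb \<equiv> (1 / (D * (1 - lb))) *\<^sub>R quarter_turn s (c - a)"
abbreviation "cc \<equiv> (1 / (D * (1 - lc))) *\<^sub>R quarter_turn s (a - b)"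

lemma s_nonzero: "s \<noteq> 0"
  using s2 by auto

lemmas D_mult = barycoord_mult[OF less_imp_neq[OF area_pos, symmetric]]

text \<open>This and the next two lemmas give the support values of \<open>K\<close> in the three
  normal directions, which become the denominators of the dual points.\<close>

lemma support_b: "det2 s b (c - a) = D * (1 - lb)"
  unfolding right_diff_distrib D_mult by (simp add: det2_def algebra_simps)

lemma support_c: "det2 s c (a - b) = D * (1 - lc)"
  unfolding right_diff_distrib D_mult by (simp add: det2_def algebra_simps)

lemma support_x: "det2 s x (c - b) = D * (la + eta)"
  unfolding distrib_left mult_minus_right D_mult by (simp add: det2_def algebra_simps)

lemma distinct: "c - a \<noteq> 0" "a - b \<noteq> 0" "c - b \<noteq> 0"
  using area_pos by (auto simp: det2_def)

lemma max_pos: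
  assumes "z \<noteq> 0" "\<And>y. y \<in> K \<Longrightarrow> det2 s y z \<le> D * r"
  shows "0 < r"
proof -
  obtain y where "y \<in> K" "0 < det2 s y z"
    using det2_pos_interior[OF zero_K assms(1) s_nonzero] .
  then have "0 < D * r"
    using assms(2) by fastforce
  then show ?thesis
    using area_pos by (simp add: zero_less_mult_iff)
qed

lemma lb_less_1: "lb < 1"
  using max_pos[OF distinct(1) b_max[unfolded support_b]] by simp

lemma lc_less_1: "lc < 1"
  using max_pos[OF distinct(2) c_max[unfolded support_c]] by simp

lemma k_pos: "0 < la + eta"
  using max_pos[OF distinct(3) x_max[unfolded support_x]] by simp

lemma polar_points:
  "bb \<in> P" "cc \<in> P" "(1 / (D * (la + eta))) *\<^sub>R quarter_turn s (c - b) \<in> P"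
  using b_max[unfolded support_b] c_max[unfolded support_c] x_max[unfolded support_x]
    area_pos lb_less_1 lc_less_1 k_pos
  by (auto intro!: quarter_turn_in_polar_body)

text \<open>The side vectors, suitably signed, have pairwise determinant \<open>D\<close>, and a
  quarter turn preserves determinants. Only the normalising factors remain.\<close>

lemma polar_dets:
  defines "v \<equiv> (1 / (D * (la + eta))) *\<^sub>R quarter_turn s (c - b)"
  shows "det2 s bb v = 1 / (D * (1 - lb) * (la + eta))"
    and "det2 s v cc = 1 / (D * (1 - lc) * (la + eta))"
    and "0 \<le> det2 s bb cc"
proof -
  have *: "det2 s (c - a) (c - b) = D" "det2 s (c - b) (a - b) = D" "det2 s (c - a) (a - b) = D"
    by (simp_all add: det2_def algebra_simps)
  show "det2 s bb v = 1 / (D * (1 - lb) * (la + eta))"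
    and "det2 s v cc = 1 / (D * (1 - lc) * (la + eta))"
    and "0 \<le> det2 s bb cc"
    using area_pos lb_less_1 lc_less_1 k_pos
    by (simp_all add: v_def det2_scaleR det2_quarter_turn[OF s2] *)
qed

text \<open>The triangle \<open>b x c\<close> lies in the cap.\<close>

lemma cap_ge: "D / 2 * eta \<le> measure lebesgue cap"
proof -
  have "det2 s (x - b) (c - b) = D * eta"
    unfolding mult_minus_right D_mult by (simp add: det2_def algebra_simps)
  moreover have "det2 s b (c - b) = det2 s c (c - b)"
    by (simp add: det2_def algebra_simps)
  ultimately show ?thesis
    using measure_triangle_le[of cap s b x c] vertices x_in x_max[of b] convex_K compact_K s2
    by (simp add: convex_Int compact_Int_closed convex_det2_halfplane closed_det2_halfplane)
qed

text \<open>With \<open>v\<close> dual to the support line at \<open>x\<close>, the triangles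
  \<open>0 bb v\<close> and \<open>0 v cc\<close> lie side by side in the polar sector.\<close>

lemma polar_wedge_ge:
  "(1 / (1 - lb) + 1 / (1 - lc)) / (la + eta) \<le> 2 * D * measure lebesgue (P \<inter> wedge s bb cc)"
proof -
  define v where "v = (1 / (D * (la + eta))) *\<^sub>R quarter_turn s (c - b)"
  note dets = polar_dets[folded v_def]
  have pos: "0 < det2 s bb v" "0 < det2 s v cc"
    unfolding dets using area_pos lb_less_1 lc_less_1 k_pos by simp_all
  have P: "convex P" "compact P" "0 \<in> P"
    by (simp_all add: convex_polar_body compact_polar_body zero_K zero_in_polar_body)
  note points = polar_points[folded v_def]
  have "(det2 s bb v + det2 s v cc) / 2 \<le>
      measure lebesgue (P \<inter> wedge s bb v) + measure lebesgue (P \<inter> wedge s v cc)"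
    unfolding add_divide_distrib
    by (intro add_mono measure_wedge_ge P points s2 less_imp_le[OF pos(1)] less_imp_le[OF pos(2)])
  also have "\<dots> \<le> measure lebesgue (P \<inter> wedge s bb cc)"
    by (rule measure_wedge_split[OF P(2) s_nonzero pos polar_dets(3)])
  finally have "2 * D * ((det2 s bb v + det2 s v cc) / 2) \<le> 2 * D * measure lebesgue (P \<inter> wedge s bb cc)"
    using area_pos by (intro mult_left_mono) auto
  moreover have "2 * D * ((det2 s bb v + det2 s v cc) / 2) = (1 / (1 - lb) + 1 / (1 - lc)) / (la + eta)"
    unfolding dets using area_pos lb_less_1 lc_less_1 k_pos
    by (simp add: add_divide_distrib distrib_left)
  ultimately show ?thesis
    by simp
qed

text \<open>
  The extra vertex of the polar sector is dual to the support line of \<open>K\<close> parallel to the chord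
  \<open>x c\<close>, and \<open>tau\<close> measures how far \<open>K\<close> reaches beyond that chord. If \<open>K\<close> reaches far, the cap is
  large; otherwise the extra vertex is far out.
\<close>

lemma refined_bounds:
  assumes eta: "0 < eta" and t: "eta < t"
  obtains tau where "0 \<le> tau" "D / 2 * (eta + tau) \<le> measure lebesgue cap"
    "0 < la * t + lb * eta + tau"
    "1 / ((1 - lb) * (la + eta)) + (eta / (la + eta) + (t - eta) / (1 - lc)) / (la * t + lb * eta + tau)
       \<le> 2 * D * measure lebesgue (P \<inter> wedge s bb cc)"
proof -
  have det_eta: "det2 s (c - b) (c - x) = D * eta" "det2 s (x - b) (c - b) = D * eta"
    unfolding mult_minus_right D_mult by (simp_all add: det2_def algebra_simps)
  have det_t: "det2 s (c - x) (a - b) = D * (t - eta)"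
    unfolding right_diff_distrib mult_minus_right D_mult by (simp add: det2_def algebra_simps)
  have cx: "c - x \<noteq> 0"
    using det_eta(1) eta area_pos by auto
  have "continuous_on K (\<lambda>z. det2 s z (c - x))"
    by (intro continuous_intros)
  then obtain y where y: "y \<in> K" "\<And>z. z \<in> K \<Longrightarrow> det2 s z (c - x) \<le> det2 s y (c - x)"
    using continuous_attains_sup[OF compact_K] vertices by blast
  define N where "N = det2 s y (c - x)"
  have N: "0 < N"
    unfolding N_def using det2_pos_interior[OF zero_K cx s_nonzero] y(2) by (metis less_le_trans)
  \<comment> \<open>Normalised so that \<open>D * tau\<close> is twice the area of the triangle
    \<open>x y c\<close>.\<close>
  define tau where "tau = (N - det2 s x c) / D"
  \<comment> \<open>The number \<open>la * t + lb * eta\<close> is the value of the functional on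
    the chord line through \<open>x\<close> and \<open>c\<close>, divided by \<open>D\<close>.
    Adding \<open>tau\<close> therefore gives the normalised support value
    \<open>N / D\<close>.\<close>
  have "D * (D * (la * t + lb * eta)) = (D * la) * (D * t) + (D * lb) * (D * eta)"
    by (simp add: algebra_simps)
  also have "\<dots> = D * det2 s x c"
    unfolding mult_minus_right D_mult unfolding det2_def vector_minus_component zero_index by algebra
  finally have "D * (la * t + lb * eta) = det2 s x c"
    using area_pos by simp
  then have k2: "la * t + lb * eta + tau = N / D"
    using area_pos by (simp add: tau_def field_simps)
  have "det2 s x c = det2 s x (c - x)"
    by (simp add: det2_diff)
  then have tau: "0 \<le> tau"
    using y(2)[OF x_in] area_pos by (simp add: tau_def N_def)

  \<comment> \<open>This expresses
    \<open>c - x = (t - eta) *\<^sub>R (c - b) + eta *\<^sub>R (a - b)\<close>. Since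
    \<open>c_max\<close> makes the last term nonpositive at \<open>y\<close>, the point
    \<open>y\<close> must lie in the cap.\<close>
  have comb: "det2 s (y - c) (c - x) = (t - eta) * det2 s (y - c) (c - b) + eta * det2 s (y - c) (a - b)"
  proof -
    have "D * det2 s (y - c) (c - x) =
        (D * (t - eta)) * det2 s (y - c) (c - b) + (D * eta) * det2 s (y - c) (a - b)"
      unfolding det_t[symmetric] det_eta(1)[symmetric]
      unfolding det2_def vector_minus_component by algebra
    also have "\<dots> = D * ((t - eta) * det2 s (y - c) (c - b) + eta * det2 s (y - c) (a - b))"
      by (simp add: algebra_simps)
    finally show ?thesis
      using area_pos by simp
  qed
  have "det2 s (y - c) (a - b) \<le> 0"
    using c_max[OF y(1)] by (simp add: det2_diff)
  moreover have "0 \<le> det2 s (y - c) (c - x)"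
    using y(2)[OF vertices(3)] by (simp add: det2_diff)
  ultimately have "0 \<le> (t - eta) * det2 s (y - c) (c - b)"
    using comb eta by (smt (verit) mult_nonneg_nonpos)
  then have "0 \<le> det2 s (y - c) (c - b)"
    using t by (simp add: zero_le_mult_iff)
  then have y_cap: "det2 s b (c - b) \<le> det2 s y (c - b)"
    by (simp add: det2_def algebra_simps)

  \<comment> \<open>The line through \<open>x\<close> and \<open>c\<close> cuts the cap in two; one
    piece contains the triangle \<open>b x c\<close>, the other \<open>x y c\<close>.\<close>
  define U where "U = cap \<inter> {z. det2 s c (x - c) \<le> det2 s z (x - c)}"
  define V where "V = cap \<inter> {z. det2 s c (c - x) \<le> det2 s z (c - x)}"
  have UV: "convex U" "compact U" "convex V" "compact V" "compact cap"
    unfolding U_def V_def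
    by (intro convex_Int compact_Int_closed convex_det2_halfplane closed_det2_halfplane convex_K compact_K)+
  have bc: "det2 s b (c - b) = det2 s c (c - b)" "det2 s x (c - x) = det2 s c (c - x)"
    "det2 s x (x - c) = det2 s c (x - c)"
    by (simp_all add: det2_def algebra_simps)
  have "0 < det2 s (c - b) (c - x)"
    unfolding det_eta(1) by (rule mult_pos_pos[OF area_pos eta])
  then have "det2 s c (x - c) \<le> det2 s b (x - c)"
    by (simp add: det2_diff)
  then have U: "b \<in> U" "x \<in> U" "c \<in> U"
    using vertices x_in bc x_max[of b] by (auto simp: U_def)
  have V: "x \<in> V" "y \<in> V" "c \<in> V"
    using vertices x_in bc x_max[of b] y y_cap by (auto simp: V_def)
  have "U \<inter> V \<subseteq> {z. det2 s z (c - x) = det2 s c (c - x)}"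
    by (auto simp: U_def V_def det2_diff)
  then have "negligible (U \<inter> V)"
    using negligible_det2_line[OF s_nonzero cx] negligible_subset by blast
  then have "measure lebesgue U + measure lebesgue V \<le> measure lebesgue cap"
    using UV by (intro measure_split_le) (auto simp: U_def V_def)
  moreover have "D * eta / 2 \<le> measure lebesgue U"
    using measure_triangle_le[OF UV(1,2) s2 U] det_eta by simp
  moreover have "D * tau / 2 \<le> measure lebesgue V"
  proof -
    have "det2 s (y - x) (c - x) = D * tau"
      using area_pos by (simp add: tau_def N_def det2_diff)
    with measure_triangle_le[OF UV(3,4) s2 V] show ?thesis by simp
  qed
  ultimately have cap: "D / 2 * (eta + tau) \<le> measure lebesgue cap"
    by (simp add: algebra_simps)

  define v where "v = (1 / (D * (la + eta))) *\<^sub>R quarter_turn s (c - b)"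
  \<comment> \<open>The point dual to the support line at \<open>y\<close>. The assumption
    \<open>eta < t\<close> places it strictly between \<open>v\<close> and \<open>cc\<close>, so the
    polar sector contains a fan of three triangles.\<close>
  define w where "w = (1 / N) *\<^sub>R quarter_turn s (c - x)"
  have "det2 s v w = eta / ((la + eta) * N)"
    using area_pos by (simp add: v_def w_def det2_scaleR det2_quarter_turn[OF s2] det_eta)
  moreover have "det2 s w cc = (t - eta) / ((1 - lc) * N)"
    using area_pos by (simp add: w_def det2_scaleR det2_quarter_turn[OF s2] det_t)
  ultimately have dets: "det2 s bb v = 1 / (D * (1 - lb) * (la + eta))"
    "det2 s v w = eta / ((la + eta) * N)" "det2 s w cc = (t - eta) / ((1 - lc) * N)"
    using polar_dets(1)[folded v_def] by simp_all
  have pos: "0 < det2 s bb v" "0 < det2 s v w" "0 < det2 s w cc" "0 < det2 s v cc"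
    unfolding dets polar_dets[folded v_def]
    using area_pos lb_less_1 lc_less_1 k_pos eta t N
    by (intro divide_pos_pos mult_pos_pos; simp)+
  have P: "convex P" "compact P" "0 \<in> P"
    by (simp_all add: convex_polar_body compact_polar_body zero_K zero_in_polar_body)
  note points = polar_points[folded v_def]
  have w: "w \<in> P"
    unfolding w_def using y N by (intro quarter_turn_in_polar_body) (auto simp: N_def)
  have "(det2 s bb v + (det2 s v w + det2 s w cc)) / 2 \<le>
      measure lebesgue (P \<inter> wedge s bb v)
      + (measure lebesgue (P \<inter> wedge s v w) + measure lebesgue (P \<inter> wedge s w cc))"
    unfolding add_divide_distrib
    by (intro add_mono measure_wedge_ge P points w s2 less_imp_le[OF pos(1)] less_imp_le[OF pos(2)]
        less_imp_le[OF pos(3)])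
  also have "\<dots> \<le> measure lebesgue (P \<inter> wedge s bb v) + measure lebesgue (P \<inter> wedge s v cc)"
    using measure_wedge_split[OF P(2) s_nonzero pos(2,3)] pos(4) by simp
  also have "\<dots> \<le> measure lebesgue (P \<inter> wedge s bb cc)"
    by (rule measure_wedge_split[OF P(2) s_nonzero pos(1,4) polar_dets(3)])
  finally have "2 * D * ((det2 s bb v + (det2 s v w + det2 s w cc)) / 2)
      \<le> 2 * D * measure lebesgue (P \<inter> wedge s bb cc)"
    using area_pos by (intro mult_left_mono) auto
  moreover have "2 * D * ((det2 s bb v + (det2 s v w + det2 s w cc)) / 2) =
      1 / ((1 - lb) * (la + eta)) + (eta / (la + eta) + (t - eta) / (1 - lc)) / (N / D)"
    unfolding dets using area_pos lb_less_1 lc_less_1 k_pos N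
    by (simp add: divide_simps)
  ultimately have "1 / ((1 - lb) * (la + eta)) + (eta / (la + eta) + (t - eta) / (1 - lc)) / (N / D)
      \<le> 2 * D * measure lebesgue (P \<inter> wedge s bb cc)"
    by (simp only:)
  then show ?thesis
    by (intro that[OF tau cap]; unfold k2) (use N area_pos in simp_all)
qed

end

section \<open>The inequalities between real numbers\<close>

text \<open>Either \<open>tau\<close> is at least a quarter of \<open>e = eta * (t - eta)\<close>,
  and the factor \<open>A\<close> gains, or it is smaller, and the extra polar vertex makes
  \<open>C\<close> gain. The ranges of \<open>la\<close>, \<open>lb\<close>, \<open>lc\<close> are
  those forced by near equality in \<open>sum_six_reciprocals\<close>, through
  \<open>m = 1 - l\<close>.\<close>

lemma refined_product_ge:
  fixes la lb lc eta t tau A C :: real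
  assumes sum: "la + lb + lc = 1"
    and la: "21/100 \<le> la" and lb: "21/100 \<le> lb" "lb \<le> 456/1000" and lc: "21/100 \<le> lc" "lc \<le> 456/1000"
    and eta: "0 < eta" and t: "(1 + eta) / 2 \<le> t" "t \<le> 1" and tau: "0 \<le> tau"
    and A: "la + eta + tau \<le> A"
    and C: "1 / ((1 - lb) * (la + eta)) + (eta / (la + eta) + (t - eta) / (1 - lc)) / (la * t + lb * eta + tau) \<le> C"
    and C0: "(1 / (1 - lb) + 1 / (1 - lc)) / (la + eta) \<le> C"
  shows "(1 / (1 - lb) + 1 / (1 - lc)) * (1 + eta * (1 - eta) / (9 * (la + eta))) \<le> A * C"
proof -
  define k k2 e p q where "k = la + eta" and "k2 = la * t + lb * eta" and "e = eta * (t - eta)"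
    and "p = 1 / (1 - lb)" and "q = 1 / (1 - lc)"
  have eta1: "eta \<le> 1" using t by simp
  have k: "0 < k" using la eta by (simp add: k_def)
  have k2: "0 < k2" unfolding k2_def using la lb eta t by (intro add_pos_pos mult_pos_pos) auto
  have p: "0 < p" and q: "0 < q" using lb lc by (simp_all add: p_def q_def)
  have "eta * ((1 - eta) / 2) \<le> eta * (t - eta)"
    using eta t by (intro mult_left_mono) auto
  then have e: "eta * (1 - eta) / 2 \<le> e" by (simp add: e_def)
  have e0: "0 \<le> eta * (1 - eta)" using eta eta1 by simp
  have "k - k2 = la * (1 - t) + (1 - lb) * eta"
    by (simp add: k_def k2_def algebra_simps)
  also have "\<dots> \<ge> 0" using la lb t eta by (intro add_nonneg_nonneg mult_nonneg_nonneg) auto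
  finally have k2k: "k2 \<le> k" by simp
  \<comment> \<open>Needed below for \<open>k2 + e / 4 \<le> 5/4 * k2\<close>.\<close>
  have ek2: "e \<le> k2"
  proof -
    have "0 \<le> t * (21/100 - eta) + 21/100 * eta + eta\<^sup>2"
    proof (cases "eta \<le> 21/100")
      case True
      then show ?thesis using eta t by (intro add_nonneg_nonneg mult_nonneg_nonneg) auto
    next
      case False
      \<comment> \<open>Completing the square: \<open>395/1000\<close> is half of
        \<open>1 - 21/100\<close>.\<close>
      have "0 \<le> (eta - 395/1000)\<^sup>2" by simp
      then have "0 \<le> (21/100 - eta) + 21/100 * eta + eta\<^sup>2"
        by (simp add: power2_eq_square algebra_simps)
      moreover have "1 * (eta - 21/100) \<ge> t * (eta - 21/100)"
        using False t by (intro mult_right_mono) auto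
      ultimately show ?thesis by (simp add: algebra_simps)
    qed
    then have "e \<le> 21/100 * t + 21/100 * eta"
      by (simp add: e_def power2_eq_square algebra_simps)
    also have "\<dots> \<le> k2"
      unfolding k2_def using la lb eta t by (intro add_mono mult_right_mono) auto
    finally show ?thesis .
  qed
  have ge: "1 + eta * (1 - eta) / (9 * k) \<le> 1 + e / (4 * k)"
  proof -
    have "eta * (1 - eta) / (9 * k) \<le> (2 * e) / (8 * k)"
      using e e0 k by (intro frac_le) auto
    then show ?thesis by simp
  qed
  have num: "eta / k + (t - eta) / (1 - lc) = q * (k2 + e) / k"
  proof -
    have "eta / k + (t - eta) / (1 - lc) = q * (eta * (la + lb) + (t - eta) * k) / k"
    proof -
      have "la + lb = 1 - lc" using sum by simp
      then have "q * (eta * (la + lb) + (t - eta) * k) / k = q * (eta * (1 - lc) + (t - eta) * k) / k"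
        by simp
      then show ?thesis using k lc unfolding q_def by (simp add: field_simps)
    qed
    also have "eta * (la + lb) + (t - eta) * k = k2 + e"
      by (simp add: k_def k2_def e_def algebra_simps)
    finally show ?thesis .
  qed
  have C1: "(p + q * ((k2 + e) / (k2 + tau))) / k \<le> C"
  proof -
    have "p / k + q * (k2 + e) / k / (k2 + tau) \<le> C"
      using C unfolding k_def[symmetric] k2_def[symmetric] num by (simp add: p_def)
    then show ?thesis
      by (simp add: add_divide_distrib[of p] mult.commute[of k])
  qed
  have A0: "0 < A" and Ak: "k \<le> A" using A tau k by (simp_all add: k_def)
  have "(p + q) * (1 + eta * (1 - eta) / (9 * k)) \<le> A * C"
  proof (cases "e / 4 \<le> tau")
    case True
    have "(p + q) * (1 + eta * (1 - eta) / (9 * k)) \<le> (p + q) * (1 + e / (4 * k))"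
      using ge p q by (intro mult_left_mono) auto
    also have "\<dots> = (k + e / 4) * ((p + q) / k)"
      using k by (simp add: field_simps)
    also have "\<dots> \<le> A * C"
      using True A C0 A0 k p q by (intro mult_mono) (auto simp: k_def p_def q_def)
    finally show ?thesis .
  next
    case False
    have e0: "0 \<le> e" using e e0 by simp
    have "1 + 6/10 * e / k \<le> 1 + (3/4 * e) / (5/4 * k2)"
      using frac_le[of "3/5 * e" "3/5 * e" k2 k] e0 k2 k2k by (simp add: field_simps)
    also have "\<dots> \<le> 1 + (3/4 * e) / (k2 + e / 4)"
      using e0 k2 ek2 by (intro add_left_mono frac_le) auto
    also have "\<dots> = (k2 + e) / (k2 + e / 4)"
      using k2 e0 by (simp add: field_simps)
    also have "\<dots> \<le> (k2 + e) / (k2 + tau)"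
      using False k2 e0 tau by (intro frac_le) auto
    finally have r: "1 + 6/10 * e / k \<le> (k2 + e) / (k2 + tau)" .
    \<comment> \<open>The ranges give \<open>p \<le> 3/2 * q\<close>. Hence the gain in the
      \<open>q\<close> term counts for \<open>4/10 * 6/10 = 24/100\<close> of \<open>e / k\<close>,
      which exceeds the required \<open>2/9\<close>.\<close>
    have "4/10 * (p + q) \<le> q"
      using lb lc by (simp add: p_def q_def divide_simps)
    then have "4/10 * (p + q) * (6/10 * e / k) \<le> q * (6/10 * e / k)"
      using e0 k by (intro mult_right_mono) auto
    moreover have "(p + q) * (eta * (1 - eta) / (9 * k)) \<le> (p + q) * (24/100 * e / k)"
    proof -
      have "eta * (1 - eta) / (9 * k) = (eta * (1 - eta) / 2) * (2 / 9) / k" by simp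
      also have "\<dots> \<le> e * (24/100) / k"
        using e e0 \<open>0 \<le> eta * (1 - eta)\<close> k by (intro divide_right_mono mult_mono) auto
      finally show ?thesis using p q by (intro mult_left_mono) auto
    qed
    ultimately have "(p + q) * (1 + eta * (1 - eta) / (9 * k)) \<le> p + q * (1 + 6/10 * e / k)"
      by (simp add: algebra_simps)
    also have "\<dots> \<le> p + q * ((k2 + e) / (k2 + tau))"
      using r q by (intro add_left_mono mult_left_mono) auto
    also have "\<dots> = k * ((p + q * ((k2 + e) / (k2 + tau))) / k)"
      using k by simp
    also have "\<dots> \<le> A * C"
      using C1 Ak A0 p q k k2 e0 tau by (intro mult_mono) auto
    finally show ?thesis .
  qed
  then show ?thesis by (simp add: p_def q_def k_def)
qed

section \<open>Stability of the arithmetic-geometric mean inequality\<close>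

lemma cubic_factor: "4 - 27 * y * (1 - y)\<^sup>2 = (1 - 3 * y)\<^sup>2 * (4 - 3 * y)" for y :: real
  by (simp add: power2_eq_square algebra_simps)

text \<open>The left side is the tangent plane of \<open>1 / (m * a)\<close> at
  \<open>m = 2/3\<close>, \<open>a = 1/3\<close>. The proof maximises over \<open>a\<close> first
  and leaves the cubic in \<open>m / 2\<close>. A bound affine in \<open>m\<close> and
  \<open>a\<close> can be summed knowing only the sums of the variables.\<close>

lemma amgm_reciprocal:
  fixes m a :: real
  assumes "0 < m" "0 < a"
  shows "27 / 2 * (1 - m / 2 - a) \<le> 1 / (m * a)"
proof (cases "m / 2 + a < 1")
  case True
  have "27 * (m / 2) * (1 - m / 2)\<^sup>2 \<le> 4"
  proof -
    have "4 - 27 * (m / 2) * (1 - m / 2)\<^sup>2 = (1 - 3 * (m / 2))\<^sup>2 * (4 - 3 * (m / 2))"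
      by (rule cubic_factor)
    also have "\<dots> \<ge> 0" using True assms by (intro mult_nonneg_nonneg) auto
    finally show ?thesis by simp
  qed
  moreover have "4 * (a * (1 - m / 2 - a)) \<le> (1 - m / 2)\<^sup>2"
    using zero_le_power2[of "1 - m / 2 - 2 * a"] by (simp add: power2_eq_square algebra_simps)
  then have "27 * (m / 2) * (4 * (a * (1 - m / 2 - a))) \<le> 27 * (m / 2) * (1 - m / 2)\<^sup>2"
    using assms by (intro mult_left_mono) auto
  ultimately have "27 / 2 * (1 - m / 2 - a) * (m * a) \<le> 1"
    by (simp add: algebra_simps)
  then show ?thesis using assms by (simp add: pos_le_divide_eq)
next
  case False
  then have "27 / 2 * (1 - m / 2 - a) \<le> 0" by simp
  also have "0 \<le> 1 / (m * a)" using assms by simp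
  finally show ?thesis .
qed

text \<open>Two rounds: the crude factor \<open>1 \<le> 4 - 3 * x\<close> confines \<open>x\<close>
  to at most \<open>13/30\<close>, which improves the factor to \<open>27/10\<close> and sharpens
  the interval.\<close>

lemma near_third:
  fixes x :: real
  assumes "0 \<le> x" "x < 1" "(1 - 3 * x)\<^sup>2 * (4 - 3 * x) < 9/100"
  shows "272/1000 \<le> x" "x \<le> 395/1000"
proof -
  have "(1 - 3 * x)\<^sup>2 * 1 \<le> (1 - 3 * x)\<^sup>2 * (4 - 3 * x)"
    using assms by (intro mult_left_mono) auto
  then have "(1 - 3 * x)\<^sup>2 < (3/10)\<^sup>2"
    using assms(3) by (simp add: power2_eq_square)
  then have "x \<le> 13/30"
    using power2_less_imp_less[of "3 * x - 1" "3/10"] by (simp add: power2_commute)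
  then have "(1 - 3 * x)\<^sup>2 * (27/10) \<le> (1 - 3 * x)\<^sup>2 * (4 - 3 * x)"
    by (intro mult_left_mono) auto
  then have *: "(1 - 3 * x)\<^sup>2 < (184/1000)\<^sup>2"
    using assms(3) by (simp add: power2_eq_square)
  show "272/1000 \<le> x" "x \<le> 395/1000"
    using power2_less_imp_less[of "3 * x - 1" "184/1000"] power2_less_imp_less[OF *] *
    by (simp_all add: power2_commute)
qed

text \<open>Stability in the inequality \<open>27 \<mu> a (1 - \<mu> - a) \<le> 1\<close>, with \<open>\<mu> = m / 2\<close>.\<close>

lemma amgm_reciprocal_stable:
  fixes m a :: real
  assumes m: "0 < m" "m < 2" and a: "0 < a" "a < 1"
    and near: "1 / (m * a) < 27 / 2 * (1 - m / 2 - a) + 45/1000"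
  shows "544/1000 \<le> m" "m \<le> 790/1000" "272/1000 \<le> a" "a \<le> 395/1000"
proof -
  define x where "x = m / 2"
  have x: "0 < x" "x < 1" using m by (simp_all add: x_def)
  have xa: "x * a < 1" using mult_strict_mono[of x 1 a 1] x a by simp
  have near': "1 < 27 * (1 - x - a) * (x * a) + 9/100 * (x * a)"
  proof -
    have "1 / (2 * x * a) * (2 * (x * a)) < (27 / 2 * (1 - x - a) + 45/1000) * (2 * (x * a))"
      using near x a by (intro mult_strict_right_mono) (auto simp: x_def)
    also have "(27 / 2 * (1 - x - a) + 45/1000) * (2 * (x * a))
        = 27 * (1 - x - a) * (x * a) + 9/100 * (x * a)"
      by (simp add: field_simps)
    finally show ?thesis using x a by simp
  qed
  have "x + a < 1"
  proof (rule ccontr)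
    assume "\<not> x + a < 1"
    then have "27 * (1 - x - a) * (x * a) \<le> 0"
      using x a by (intro mult_nonpos_nonneg[of "27 * (1 - x - a)"]) auto
    with near' xa show False by linarith
  qed
  then have "(x + a)\<^sup>2 < 1"
    using x a power_strict_mono[of "x + a" 1 2] by simp
  moreover have "4 * (x * a) \<le> (x + a)\<^sup>2"
    using zero_le_power2[of "x - a"] by (simp add: power2_eq_square algebra_simps)
  ultimately have quarter: "x * a < 1/4" by simp
  \<comment> \<open>The expression is symmetric in \<open>x\<close> and \<open>a\<close>, so the
    bound is stated for either one as \<open>y\<close>. Since \<open>x * a < 1/4\<close>, the error
    \<open>4 * (9/100) * (x * a)\<close> stays below \<open>9/100\<close>.\<close>
  have bound: "(1 - 3 * y)\<^sup>2 * (4 - 3 * y) < 9/100"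
    if "0 < y" "y * b = x * a" "x + a = y + b" for y b
  proof -
    have "4 * (b * (1 - y - b)) \<le> (1 - y)\<^sup>2"
      using zero_le_power2[of "1 - y - 2 * b"] by (simp add: power2_eq_square algebra_simps)
    then have "27 * y * (4 * (b * (1 - y - b))) \<le> 27 * y * (1 - y)\<^sup>2"
      using that by (intro mult_left_mono) auto
    moreover have "27 * y * (4 * (b * (1 - y - b))) = 4 * (27 * (1 - (y + b)) * (y * b))"
      by (simp add: algebra_simps)
    moreover have "27 * (1 - x - a) * (x * a) = 27 * (1 - (y + b)) * (y * b)"
      unfolding that(2) that(3)[symmetric] by (simp add: algebra_simps)
    ultimately have "4 * (27 * (1 - x - a) * (x * a)) \<le> 27 * y * (1 - y)\<^sup>2"
      by (simp only:)
    with near' have "4 * (1 - 9/100 * (x * a)) < 27 * y * (1 - y)\<^sup>2"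
      by argo
    then show ?thesis using quarter unfolding cubic_factor[symmetric] by argo
  qed
  show "544/1000 \<le> m" "m \<le> 790/1000" "272/1000 \<le> a" "a \<le> 395/1000"
    using near_third[of x] near_third[of a] bound[of x a] bound[of a x] x a
    by (simp_all add: x_def mult.commute)
qed

text \<open>Six instances of \<open>amgm_reciprocal\<close> have affine parts adding up to exactly
  \<open>27\<close>. Each variable occurs in two of them, so a total excess below
  \<open>9/100\<close> leaves one of the two with excess below \<open>45/1000\<close>.\<close>

lemma sum_six_reciprocals:
  fixes m1 m2 m3 a1 a2 a3 :: real
  assumes m: "0 < m1" "0 < m2" "0 < m3" "m1 + m2 + m3 = 2"
    and a: "0 < a1" "0 < a2" "0 < a3" "a1 + a2 + a3 = 1"
  defines "T \<equiv> (1 / m2 + 1 / m3) / a1 + (1 / m3 + 1 / m1) / a2 + (1 / m1 + 1 / m2) / a3"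
  shows "27 \<le> T"
    and "T < 27 + 9/100 \<Longrightarrow> 544/1000 \<le> m1 \<and> m1 \<le> 790/1000 \<and> 272/1000 \<le> a1 \<and> a1 \<le> 395/1000"
proof -
  have T: "T = 1 / (m2 * a1) + 1 / (m3 * a1) + 1 / (m3 * a2) + 1 / (m1 * a2) + 1 / (m1 * a3) + 1 / (m2 * a3)"
    by (simp add: T_def add_divide_distrib)
  have s: "27 / 2 * (1 - m2 / 2 - a1) + 27 / 2 * (1 - m3 / 2 - a1) + 27 / 2 * (1 - m3 / 2 - a2)
      + 27 / 2 * (1 - m1 / 2 - a2) + 27 / 2 * (1 - m1 / 2 - a3) + 27 / 2 * (1 - m2 / 2 - a3) = 27"
    using m a by argo
  note g = amgm_reciprocal[OF m(2) a(1)] amgm_reciprocal[OF m(3) a(1)] amgm_reciprocal[OF m(3) a(2)]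
    amgm_reciprocal[OF m(1) a(2)] amgm_reciprocal[OF m(1) a(3)] amgm_reciprocal[OF m(2) a(3)]
  show "27 \<le> T" unfolding T using g s by linarith
  assume T': "T < 27 + 9/100"
  have a1: "1 / (m2 * a1) < 27 / 2 * (1 - m2 / 2 - a1) + 45/1000
      \<or> 1 / (m3 * a1) < 27 / 2 * (1 - m3 / 2 - a1) + 45/1000"
    using T' g s unfolding T by linarith
  have m1: "1 / (m1 * a2) < 27 / 2 * (1 - m1 / 2 - a2) + 45/1000
      \<or> 1 / (m1 * a3) < 27 / 2 * (1 - m1 / 2 - a3) + 45/1000"
    using T' g s unfolding T by linarith
  have less: "m1 < 2" "m2 < 2" "m3 < 2" "a1 < 1" "a2 < 1" "a3 < 1" using m a by auto
  show "544/1000 \<le> m1 \<and> m1 \<le> 790/1000 \<and> 272/1000 \<le> a1 \<and> a1 \<le> 395/1000"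
    using m1 a1 amgm_reciprocal_stable[OF m(1) less(1) a(2) less(5)]
      amgm_reciprocal_stable[OF m(1) less(1) a(3) less(6)]
      amgm_reciprocal_stable[OF m(2) less(2) a(1) less(4)]
      amgm_reciprocal_stable[OF m(3) less(3) a(1) less(4)] by blast
qed

text \<open>A small gain forces \<open>e * (1 - e)\<close> to be small, so \<open>e\<close> is near
  \<open>0\<close> or near \<open>1\<close>, and on either side the gain is linear in the distance
  to that end.\<close>

lemma eta_dichotomy:
  fixes l e g :: real
  assumes l: "21/100 \<le> l" "l \<le> 456/1000" and e: "0 \<le> e" "e \<le> 1"
    and g: "e * (1 - e) / (9 * (l + e)) \<le> g" "g \<le> 141/10000"
  shows "e \<le> 1/10 \<and> 17/100 * e \<le> g \<or> 78/100 \<le> e \<and> 59/1000 * (1 - e) \<le> g"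
proof -
  have "e * (1 - e) \<le> g * (9 * (l + e))"
    using g(1) l e by (simp add: pos_divide_le_eq)
  moreover have g0: "0 \<le> g"
    using g(1) l e by (intro order_trans[OF divide_nonneg_nonneg g(1)]) auto
  then have "g * (9 * (l + e)) \<le> g * (9 * (456/1000 + e))"
    using l by (intro mult_left_mono) auto
  ultimately have main: "e * (1 - e) \<le> g * (9 * (456/1000 + e))" by linarith
  also have "\<dots> \<le> 141/10000 * (9 * (456/1000 + e))"
    using g e by (intro mult_right_mono) auto
  finally have upper: "e - e * e \<le> 141/10000 * (9 * (456/1000 + e))"
    by (simp add: algebra_simps)
  have "\<not> (1/10 < e \<and> e < 78/100)"
  proof
    assume e': "1/10 < e \<and> e < 78/100"
    then have "0 < (e - 1/10) * (78/100 - e)"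
      by (intro mult_pos_pos) auto
    moreover have "(e - 1/10) * (78/100 - e) = 88/100 * e - e * e - 78/1000"
      by (simp add: field_simps)
    ultimately have "0 < 88/100 * e - e * e - 78/1000" by (simp only:)
    with upper conjunct2[OF e'] show False by simp
  qed
  then consider "e \<le> 1/10" | "78/100 \<le> e" by linarith
  then show ?thesis
  proof cases
    case 1
    have "e * (9/10) \<le> e * (1 - e)" using 1 e by (intro mult_left_mono) auto
    also note main
    also have "g * (9 * (456/1000 + e)) \<le> g * (9 * (556/1000))"
      using 1 g0 by (intro mult_left_mono) auto
    finally show ?thesis using 1 e by simp
  next
    case 2
    have "(78/100) * (1 - e) \<le> e * (1 - e)" using 2 e by (intro mult_right_mono) auto
    also note main
    also have "g * (9 * (456/1000 + e)) \<le> g * (9 * (1456/1000))"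
      using e g0 by (intro mult_left_mono) auto
    finally show ?thesis using 2 e g0 by simp
  qed
qed

text \<open>Argument by contradiction. The two bounds in \<open>d\<close> correspond to comparing
  \<open>K\<close> with the inscribed triangle and with an approximation of the anticomplementary
  one. The first gives \<open>d \<le> 3\<close>, so the excess \<open>27 / 900 * d\<close> stays
  within the tolerance \<open>9/100\<close> of \<open>sum_six_reciprocals\<close>.\<close>

lemma product_of_sums_ge:
  fixes l1 l2 l3 e1 e2 e3 A1 A2 A3 C1 C2 C3 d :: real
  assumes l: "l1 + l2 + l3 = 1" "l1 < 1" "l2 < 1" "l3 < 1"
    and k: "0 < l1 + e1" "0 < l2 + e2" "0 < l3 + e3"
    and e: "0 \<le> e1" "e1 \<le> 1" "0 \<le> e2" "e2 \<le> 1" "0 \<le> e3" "e3 \<le> 1"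
    and A: "l1 + e1 \<le> A1" "l2 + e2 \<le> A2" "l3 + e3 \<le> A3"
  defines "c1 \<equiv> 1 / (1 - l2) + 1 / (1 - l3)" and "c2 \<equiv> 1 / (1 - l3) + 1 / (1 - l1)"
    and "c3 \<equiv> 1 / (1 - l1) + 1 / (1 - l2)"
  assumes C: "c1 / (l1 + e1) \<le> C1" "c2 / (l2 + e2) \<le> C2" "c3 / (l3 + e3) \<le> C3"
    and gain: "\<lbrakk>21/100 \<le> l1; l1 \<le> 456/1000; 21/100 \<le> l2; l2 \<le> 456/1000; 21/100 \<le> l3; l3 \<le> 456/1000\<rbrakk>
      \<Longrightarrow> c1 * (1 + e1 * (1 - e1) / (9 * (l1 + e1))) \<le> A1 * C1
        \<and> c2 * (1 + e2 * (1 - e2) / (9 * (l2 + e2))) \<le> A2 * C2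
        \<and> c3 * (1 + e3 * (1 - e3) / (9 * (l3 + e3))) \<le> A3 * C3"
    and d: "d \<le> e1 + e2 + e3"
      "\<And>m. \<lbrakk>78/100 \<le> m; m \<le> e1; m \<le> e2; m \<le> e3\<rbrakk> \<Longrightarrow> d \<le> 3 * (1 - m) / (3 * m - 1)"
  shows "27 * (1 + d / 900) \<le> (A1 + A2 + A3) * (C1 + C2 + C3)"
proof (rule ccontr)
  assume "\<not> ?thesis"
  then have small: "(A1 + A2 + A3) * (C1 + C2 + C3) < 27 + 3/100 * d" by simp
  have c: "0 < c1" "0 < c2" "0 < c3"
    using l by (auto simp: c1_def c2_def c3_def intro!: add_pos_pos)
  have A0: "0 < A1" "0 < A2" "0 < A3" using A k by auto
  define S where "S = A1 + A2 + A3"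
  have S: "0 < S" using A0 by (simp add: S_def)
  define a1 a2 a3 where "a1 = A1 / S" and "a2 = A2 / S" and "a3 = A3 / S"
  have a: "0 < a1" "0 < a2" "0 < a3" "a1 + a2 + a3 = 1"
    using A0 S by (simp_all add: a1_def a2_def a3_def add_divide_distrib[symmetric] S_def)
  \<comment> \<open>The relative excess in each sector. The product becomes the sum of the
    \<open>c / a * (1 + g)\<close>, separating the loss in the six reciprocals from the loss inside
    the sectors.\<close>
  define g1 g2 g3 where "g1 = A1 * C1 / c1 - 1" and "g2 = A2 * C2 / c2 - 1" and "g3 = A3 * C3 / c3 - 1"
  have ratio: "A / k' \<le> A * C / c"
    if "c / k' \<le> C" "0 < k'" "0 < A" "0 < c" for A C c k' :: real
  proof -
    have "A / k' = A * (c / k') / c" using that by simp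
    also have "\<dots> \<le> A * C / c" using that by (intro divide_right_mono mult_left_mono) auto
    finally show ?thesis .
  qed
  have Ak: "A1 / (l1 + e1) \<le> 1 + g1" "A2 / (l2 + e2) \<le> 1 + g2" "A3 / (l3 + e3) \<le> 1 + g3"
    using ratio[OF C(1) k(1) A0(1) c(1)] ratio[OF C(2) k(2) A0(2) c(2)] ratio[OF C(3) k(3) A0(3) c(3)]
    by (simp_all add: g1_def g2_def g3_def)
  moreover have "1 \<le> A1 / (l1 + e1)" "1 \<le> A2 / (l2 + e2)" "1 \<le> A3 / (l3 + e3)"
    using A k by simp_all
  ultimately have g0: "0 \<le> g1" "0 \<le> g2" "0 \<le> g3" by linarith+
  have "S * (C1 + C2 + C3) = c1 / a1 * (1 + g1) + c2 / a2 * (1 + g2) + c3 / a3 * (1 + g3)"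
    using c A0 S by (simp add: g1_def g2_def g3_def a1_def a2_def a3_def distrib_left)
  then have F: "c1 / a1 * (1 + g1) + c2 / a2 * (1 + g2) + c3 / a3 * (1 + g3) < 27 + 3/100 * d"
    using small by (simp add: S_def)
  have ca: "0 < c1 / a1" "0 < c2 / a2" "0 < c3 / a3" using c a by simp_all
  have F0: "c1 / a1 + c2 / a2 + c3 / a3 < 27 + 9/100"
  proof -
    have "c1 / a1 * 1 \<le> c1 / a1 * (1 + g1)" "c2 / a2 * 1 \<le> c2 / a2 * (1 + g2)"
      "c3 / a3 * 1 \<le> c3 / a3 * (1 + g3)"
      using g0 ca by (intro mult_left_mono; simp)+
    then show ?thesis using F d(1) e by simp
  qed
  have m: "0 < 1 - l1" "0 < 1 - l2" "0 < 1 - l3" using l by simp_all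
  have msum: "(1 - l1) + (1 - l2) + (1 - l3) = 2" "(1 - l2) + (1 - l3) + (1 - l1) = 2"
    "(1 - l3) + (1 - l1) + (1 - l2) = 2" using l by simp_all
  have asum: "a2 + a3 + a1 = 1" "a3 + a1 + a2 = 1" using a by simp_all
  have b1: "544/1000 \<le> 1 - l1 \<and> 1 - l1 \<le> 790/1000 \<and> 272/1000 \<le> a1 \<and> a1 \<le> 395/1000"
    using sum_six_reciprocals(2)[OF m msum(1) a] F0 by (simp add: c1_def c2_def c3_def)
  have b2: "544/1000 \<le> 1 - l2 \<and> 1 - l2 \<le> 790/1000 \<and> 272/1000 \<le> a2 \<and> a2 \<le> 395/1000"
    using sum_six_reciprocals(2)[OF m(2,3,1) msum(2) a(2,3,1) asum(1)] F0
    by (simp add: c1_def c2_def c3_def add_ac)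
  have b3: "544/1000 \<le> 1 - l3 \<and> 1 - l3 \<le> 790/1000 \<and> 272/1000 \<le> a3 \<and> a3 \<le> 395/1000"
    using sum_six_reciprocals(2)[OF m(3,1,2) msum(3) a(3,1,2) asum(2)] F0
    by (simp add: c1_def c2_def c3_def add_ac)
  have lb: "21/100 \<le> l1" "l1 \<le> 456/1000" "21/100 \<le> l2" "l2 \<le> 456/1000" "21/100 \<le> l3" "l3 \<le> 456/1000"
    using b1 b2 b3 by simp_all
  have big: "64/10 \<le> (1 / x + 1 / y) / z" if "0 < x" "x \<le> 790/1000" "0 < y" "y \<le> 790/1000"
    "0 < z" "z \<le> 395/1000" for x y z :: real
  proof -
    have "64/10 \<le> (1 / (790/1000) + 1 / (790/1000)) / (395/1000 :: real)" by simp
    also have "\<dots> \<le> (1 / x + 1 / y) / z"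
      using that by (intro frac_le add_mono) auto
    finally show ?thesis .
  qed
  have "64/10 * g1 \<le> c1 / a1 * g1" "64/10 * g2 \<le> c2 / a2 * g2" "64/10 * g3 \<le> c3 / a3 * g3"
    unfolding c1_def c2_def c3_def using b1 b2 b3 g0 by (intro mult_right_mono big; simp)+
  moreover have "27 \<le> c1 / a1 + c2 / a2 + c3 / a3"
    using sum_six_reciprocals(1)[OF m msum(1) a] by (simp add: c1_def c2_def c3_def)
  ultimately have G: "64/10 * (g1 + g2 + g3) < 3/100 * d"
    using F unfolding distrib_left mult_1_right by linarith
  have "64/10 * (g1 + g2 + g3) \<le> 9/100" using G d(1) e by linarith
  then have gs: "g1 \<le> 141/10000" "g2 \<le> 141/10000" "g3 \<le> 141/10000"
    using g0 by simp_all
  have gain': "e1 * (1 - e1) / (9 * (l1 + e1)) \<le> g1" "e2 * (1 - e2) / (9 * (l2 + e2)) \<le> g2"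
    "e3 * (1 - e3) / (9 * (l3 + e3)) \<le> g3"
    using gain[OF lb] c by (simp_all add: g1_def g2_def g3_def pos_le_divide_eq le_diff_eq mult.commute add.commute)
  note dich = eta_dichotomy[OF lb(1,2) e(1,2) gain'(1) gs(1)] eta_dichotomy[OF lb(3,4) e(3,4) gain'(2) gs(2)]
    eta_dichotomy[OF lb(5,6) e(5,6) gain'(3) gs(3)]
  \<comment> \<open>A side with large reach and one with small reach cannot coexist: the first makes
    \<open>A\<close> at least \<open>99/100\<close>, hence \<open>S\<close> large, and then
    \<open>A'\<close> is too small to be \<open>272/1000\<close> of \<open>S\<close>.\<close>
  have mixed: False
    if "78/100 \<le> x" "y \<le> 1/10" "21/100 \<le> l" "l' \<le> 456/1000" "l + x \<le> A" "A' / (l' + y) \<le> 1 + g" "g \<le> 141/10000"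
      "A / S \<le> 395/1000" "272/1000 \<le> A' / S" "0 < l' + y"
    for x y l l' A A' g :: real
  proof -
    have "A' \<le> (1 + g) * (l' + y)" using that by (simp add: pos_divide_le_eq)
    also have "\<dots> \<le> (1 + 141/10000) * (556/1000)" using that by (intro mult_mono) auto
    finally have "A' \<le> 564/1000" by simp
    moreover have "A \<le> 395/1000 * S" "272/1000 * S \<le> A'"
      using that S by (simp_all add: pos_divide_le_eq pos_le_divide_eq)
    ultimately show False using that by linarith
  qed
  show False
  proof (cases "e1 \<le> 1/10 \<and> e2 \<le> 1/10 \<and> e3 \<le> 1/10")
    case True
    then have "17/100 * e1 \<le> g1" "17/100 * e2 \<le> g2" "17/100 * e3 \<le> g3"
      using dich by auto
    then show False using G d(1) e by argo
  next
    case False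
    have low: "\<not> e1 \<le> 1/10 \<or> \<not> 78/100 \<le> e2" "\<not> e1 \<le> 1/10 \<or> \<not> 78/100 \<le> e3"
      "\<not> e2 \<le> 1/10 \<or> \<not> 78/100 \<le> e1" "\<not> e2 \<le> 1/10 \<or> \<not> 78/100 \<le> e3"
      "\<not> e3 \<le> 1/10 \<or> \<not> 78/100 \<le> e1" "\<not> e3 \<le> 1/10 \<or> \<not> 78/100 \<le> e2"
      using mixed[of e2 e1 l2 l1 A2 A1 g1] mixed[of e3 e1 l3 l1 A3 A1 g1] mixed[of e1 e2 l1 l2 A1 A2 g2]
        mixed[of e3 e2 l3 l2 A3 A2 g2] mixed[of e1 e3 l1 l3 A1 A3 g3] mixed[of e2 e3 l2 l3 A2 A3 g3]
        lb A Ak gs b1 b2 b3 k by (auto simp: a1_def a2_def a3_def)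
    then have hi: "78/100 \<le> e1" "78/100 \<le> e2" "78/100 \<le> e3"
      using dich False by auto
    then have gh: "59/1000 * (1 - e1) \<le> g1" "59/1000 * (1 - e2) \<le> g2" "59/1000 * (1 - e3) \<le> g3"
      using dich by auto
    define m where "m = min e1 (min e2 e3)"
    have m: "78/100 \<le> m" "m \<le> e1" "m \<le> e2" "m \<le> e3" "m \<le> 1" using hi e by (auto simp: m_def)
    have "59/1000 * (1 - m) \<le> g1 + g2 + g3"
      using gh g0 unfolding m_def by linarith
    \<comment> \<open>Here \<open>134/100 = 3 * (78/100) - 1\<close>.\<close>
    moreover have "d \<le> 3 * (1 - m) / (134/100)"
      using m by (intro order_trans[OF d(2)[of m] divide_left_mono]) auto
    ultimately show False using G m by simp
  qed
qed

section \<open>Banach-Mazur distance to a triangle\<close>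

lemma det2_zero_imp_parallel:
  fixes x y :: "real ^ 2"
  assumes "det2 1 x y = 0" "x \<noteq> 0"
  shows "\<exists>k. y = k *\<^sub>R x"
proof -
  consider "x $ 1 \<noteq> 0" | "x $ 2 \<noteq> 0"
    using assms(2) by (auto simp: vec_eq_iff forall_2)
  then show ?thesis
  proof cases
    case 1
    then have "y = (y $ 1 / x $ 1) *\<^sub>R x"
      using assms(1) by (auto simp: vec_eq_iff forall_2 det2_def field_simps)
    then show ?thesis by blast
  next
    case 2
    then have "y = (y $ 2 / x $ 2) *\<^sub>R x"
      using assms(1) by (auto simp: vec_eq_iff forall_2 det2_def field_simps)
    then show ?thesis by blast
  qed
qed

lemma triangle_vertices:
  fixes T :: "(real ^ 2) set"
  assumes "2 simplex T"
  obtains p q r where "T = convex hull {p, q, r}" "det2 1 (q - p) (r - p) \<noteq> 0"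
proof -
  obtain C where C: "\<not> affine_dependent C" "int (card C) = 3" "T = convex hull C"
    using assms by (auto simp: simplex_def)
  then have "card C = 3" by simp
  then obtain p q r where pqr: "C = {p, q, r}" "p \<noteq> q" "q \<noteq> r" "p \<noteq> r"
    by (auto simp: card_3_iff)
  have "det2 1 (q - p) (r - p) \<noteq> 0"
  proof
    assume "det2 1 (q - p) (r - p) = 0"
    then obtain k where "r - p = k *\<^sub>R (q - p)"
      using det2_zero_imp_parallel pqr(2) by force
    then have "collinear {0, q - p, r - p}"
      by (simp add: collinear_lemma)
    then have "collinear {q, p, r}"
      by (simp add: collinear_3)
    then show False
      using C(1) pqr by (simp add: collinear_3_eq_affine_dependent insert_commute)
  qed
  then show ?thesis
    using that C(3) pqr(1) by blast
qed

lemma barycoord_expansion: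
  assumes "det2 s (b - a) (c - a) \<noteq> 0"
  shows "barycoord s a b c z *\<^sub>R a + barycoord s b c a z *\<^sub>R b + barycoord s c a b z *\<^sub>R c = z"
proof -
  have "det2 s (b - a) (c - a) *\<^sub>R
      (barycoord s a b c z *\<^sub>R a + barycoord s b c a z *\<^sub>R b + barycoord s c a b z *\<^sub>R c)
    = det2 s (b - z) (c - z) *\<^sub>R a + det2 s (c - z) (a - z) *\<^sub>R b + det2 s (a - z) (b - z) *\<^sub>R c"
    unfolding scaleR_add_right scaleR_scaleR barycoord_mult[OF assms] ..
  also have "\<dots> = det2 s (b - a) (c - a) *\<^sub>R z"
    by (simp add: vec_eq_iff forall_2 det2_def algebra_simps)
  finally show ?thesis
    using assms by simp
qed

text \<open>The map taking \<open>a\<close>, \<open>b\<close>, \<open>c\<close> to \<open>p\<close>,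
  \<open>q\<close>, \<open>r\<close>. Its linear part \<open>f\<close> sends \<open>b - a\<close> to
  \<open>q - p\<close> and \<open>c - a\<close> to \<open>r - p\<close>, and is injective by
  Cramer's rule.\<close>

lemma affine_map_of_triangles:
  fixes a b c p q r :: "real ^ 2"
  assumes abc: "det2 1 (b - a) (c - a) \<noteq> 0" and pqr: "det2 1 (q - p) (r - p) \<noteq> 0"
  shows "invertible_affine_map
    (\<lambda>z. barycoord 1 a b c z *\<^sub>R p + barycoord 1 b c a z *\<^sub>R q + barycoord 1 c a b z *\<^sub>R r)"
    (is "invertible_affine_map ?A")
proof -
  define D where "D = det2 1 (b - a) (c - a)"
  define f where "f z = (det2 1 z (c - a) / D) *\<^sub>R (q - p) + (det2 1 (b - a) z / D) *\<^sub>R (r - p)" for z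
  have D: "D \<noteq> 0" using abc by (simp add: D_def)
  have lin: "linear f"
    by (rule linearI)
      (simp_all add: f_def det2_add det2_scaleR add_divide_distrib scaleR_add_left scaleR_add_right)
  have "z = 0" if "f z = 0" for z
  proof -
    have "det2 1 (f z) (r - p) = det2 1 z (c - a) / D * det2 1 (q - p) (r - p)"
      "det2 1 (q - p) (f z) = det2 1 (b - a) z / D * det2 1 (q - p) (r - p)"
      by (simp_all add: f_def det2_add det2_scaleR)
    then have "det2 1 z (c - a) = 0" "det2 1 (b - a) z = 0"
      using that pqr D by simp_all
    moreover have "D *\<^sub>R z = det2 1 z (c - a) *\<^sub>R (b - a) + det2 1 (b - a) z *\<^sub>R (c - a)"
      by (simp add: D_def vec_eq_iff forall_2 det2_def algebra_simps)
    ultimately show ?thesis using D by simp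
  qed
  then have "inj f"
    using linear_injective_0[OF lin] by blast
  then have "bij f"
    using linear_injective_imp_surjective[OF lin] by (simp add: bij_def)
  have b: "barycoord 1 b c a z = barycoord 1 b c a 0 + det2 1 z (c - a) / D"
    "barycoord 1 c a b z = barycoord 1 c a b 0 + det2 1 (b - a) z / D" for z
  proof -
    have "D * barycoord 1 b c a z = D * barycoord 1 b c a 0 + det2 1 z (c - a)"
      "D * barycoord 1 c a b z = D * barycoord 1 c a b 0 + det2 1 (b - a) z"
      unfolding D_def barycoord_mult[OF abc] by (simp_all add: det2_def algebra_simps)
    then show "barycoord 1 b c a z = barycoord 1 b c a 0 + det2 1 z (c - a) / D"
      "barycoord 1 c a b z = barycoord 1 c a b 0 + det2 1 (b - a) z / D"
      using D by (simp_all add: field_simps)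
  qed
  have "?A z = f z + ?A 0" for z
  proof -
    have a: "barycoord 1 a b c w = 1 - barycoord 1 b c a w - barycoord 1 c a b w" for w
      using barycoord_sum[OF abc, of w] by simp
    show ?thesis
      unfolding a b[of z] f_def by (simp add: algebra_simps)
  qed
  then show ?thesis
    unfolding invertible_affine_map_def using lin \<open>bij f\<close> by blast
qed

text \<open>The affine map absorbs the shift, so the origin can be moved to a maximum point of
  \<open>u\<close>. The reverse inclusion is the same one for the shift by
  \<open>- v\<close>.\<close>

lemma banach_mazur_distance_translation:
  "banach_mazur_distance ((\<lambda>z. z - v) ` K) L = banach_mazur_distance K L"
proof -
  have shift: "invertible_affine_map (\<lambda>z. A (z - w))" if A: "invertible_affine_map A" for A :: "'a \<Rightarrow> 'a" and w
  proof -
    obtain f b where f: "linear f" "bij f" "A = (\<lambda>z. f z + b)"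
      using A unfolding invertible_affine_map_def by blast
    then have "(\<lambda>z. A (z - w)) = (\<lambda>z. f z + (b - f w))"
      by (simp add: linear_diff fun_eq_iff algebra_simps)
    with f show ?thesis
      unfolding invertible_affine_map_def by blast
  qed
  have sub: "{t. 1 \<le> t \<and> (\<exists>A x. invertible_affine_map A \<and> L \<subseteq> A ` (\<lambda>z. z - w) ` M
        \<and> A ` (\<lambda>z. z - w) ` M \<subseteq> (\<lambda>z. t *\<^sub>R z + x) ` L)}
      \<subseteq> {t. 1 \<le> t \<and> (\<exists>A x. invertible_affine_map A \<and> L \<subseteq> A ` M \<and> A ` M \<subseteq> (\<lambda>z. t *\<^sub>R z + x) ` L)}"
    (is "?S1 \<subseteq> ?S2") for w M
  proof
    fix t assume "t \<in> ?S1"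
    then obtain A x where A: "1 \<le> t" "invertible_affine_map A" "L \<subseteq> (\<lambda>z. A (z - w)) ` M"
      "(\<lambda>z. A (z - w)) ` M \<subseteq> (\<lambda>z. t *\<^sub>R z + x) ` L"
      by (auto simp: image_image)
    from A(1) shift[OF A(2)] A(3,4) show "t \<in> ?S2" by blast
  qed
  have unshift: "(\<lambda>z. z - - v) ` (\<lambda>z. z - v) ` K = K"
    by (simp add: image_image)
  show ?thesis
    unfolding banach_mazur_distance_def
    by (intro arg_cong[where f = Inf] equalityI sub sub[of "- v" "(\<lambda>z. z - v) ` K", unfolded unshift])
qed

lemma banach_mazur_distance_le:
  assumes "1 \<le> t" "invertible_affine_map A" "L \<subseteq> A ` K" "A ` K \<subseteq> (\<lambda>z. t *\<^sub>R z + x) ` L"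
  shows "banach_mazur_distance K L \<le> t"
  unfolding banach_mazur_distance_def
  by (rule cInf_lower) (use assms in \<open>auto intro!: bdd_belowI[of _ 1]\<close>)

text \<open>Map the triangle \<open>a b c\<close> onto \<open>T\<close>. Lower bounds on the
  barycentric coordinates put \<open>K\<close> into a homothetic copy with ratio one plus the sum of
  the defects. The second claim shows that the infimum is over a nonempty set, which a lower bound
  for it requires.\<close>

lemma banach_mazur_distance_triangle_le:
  fixes K T :: "(real ^ 2) set"
  assumes "2 simplex T" and K: "convex K" "a \<in> K" "b \<in> K" "c \<in> K"
    and abc: "det2 1 (b - a) (c - a) \<noteq> 0"
    and e: "0 \<le> ea" "0 \<le> eb" "0 \<le> ec"
    and bounds: "\<And>z. z \<in> K \<Longrightarrow> - ea \<le> barycoord 1 a b c z"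
      "\<And>z. z \<in> K \<Longrightarrow> - eb \<le> barycoord 1 b c a z"
      "\<And>z. z \<in> K \<Longrightarrow> - ec \<le> barycoord 1 c a b z"
  shows "banach_mazur_distance K T \<le> 1 + (ea + eb + ec)"
    and "\<exists>t\<ge>1. \<exists>A x. invertible_affine_map A \<and> T \<subseteq> A ` K \<and> A ` K \<subseteq> (\<lambda>z. t *\<^sub>R z + x) ` T"
proof -
  obtain p q r where T: "T = convex hull {p, q, r}" and pqr: "det2 1 (q - p) (r - p) \<noteq> 0"
    using triangle_vertices[OF assms(1)] by blast
  define A where
    "A z = barycoord 1 a b c z *\<^sub>R p + barycoord 1 b c a z *\<^sub>R q + barycoord 1 c a b z *\<^sub>R r" for z
  define t where "t = 1 + (ea + eb + ec)"
  have t: "1 \<le> t" using e by (simp add: t_def)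
  have inv: "invertible_affine_map A"
    unfolding A_def by (rule affine_map_of_triangles[OF abc pqr])
  then obtain f v where f: "linear f" "A = (\<lambda>z. f z + v)"
    by (auto simp: invertible_affine_map_def)
  then have "A ` K = (+) v ` f ` K"
    by (auto simp: image_image add.commute)
  then have "convex (A ` K)"
    using f K by (simp add: convex_linear_image)
  moreover have "A a = p" "A b = q" "A c = r"
    using abc det2_cyclic[of 1 c b a] by (simp_all add: A_def barycoord_def)
  ultimately have sub: "T \<subseteq> A ` K"
    unfolding T using K by (intro hull_minimal) auto
  have sup: "A ` K \<subseteq> (\<lambda>z. t *\<^sub>R z + - (ea *\<^sub>R p + eb *\<^sub>R q + ec *\<^sub>R r)) ` T"
  proof (intro image_subsetI)
    fix z assume z: "z \<in> K"
    \<comment> \<open>Shifting the coordinates by the defects and dividing by \<open>t\<close> makes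
      them nonnegative with sum \<open>1\<close>.\<close>
    define w where "w = ((barycoord 1 a b c z + ea) / t) *\<^sub>R p + ((barycoord 1 b c a z + eb) / t) *\<^sub>R q
      + ((barycoord 1 c a b z + ec) / t) *\<^sub>R r"
    have "(barycoord 1 a b c z + ea) / t + (barycoord 1 b c a z + eb) / t + (barycoord 1 c a b z + ec) / t = 1"
      using barycoord_sum[OF abc, of z] t by (simp add: add_divide_distrib[symmetric]) (simp add: t_def)
    then have "w \<in> T"
      unfolding T convex_hull_3 w_def using bounds[OF z] t
      by (force simp: divide_nonneg_nonneg)
    moreover have "t *\<^sub>R w + - (ea *\<^sub>R p + eb *\<^sub>R q + ec *\<^sub>R r) = A z"
      using t by (simp add: w_def A_def scaleR_add_right scaleR_add_left)
    ultimately show "A z \<in> (\<lambda>z. t *\<^sub>R z + - (ea *\<^sub>R p + eb *\<^sub>R q + ec *\<^sub>R r)) ` T"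
      by (metis (mono_tags, lifting) image_eqI)
  qed
  show "banach_mazur_distance K T \<le> 1 + (ea + eb + ec)"
    using banach_mazur_distance_le[OF t inv sub sup] by (simp add: t_def)
  show "\<exists>t\<ge>1. \<exists>A x. invertible_affine_map A \<and> T \<subseteq> A ` K \<and> A ` K \<subseteq> (\<lambda>z. t *\<^sub>R z + x) ` T"
    using t inv sub sup by blast
qed

section \<open>Sectors combined\<close>

context sector
begin

text \<open>Exchanging \<open>b\<close> and \<open>c\<close> while reversing orientation reduces the
  case of a large coordinate of \<open>x\<close> at \<open>c\<close> to that of a large coordinate
  at \<open>b\<close>.\<close>

lemma sector_reflect: "sector K (- s) a c b x"
  by unfold_locales
    (use convex_K compact_K zero_K s2 vertices x_in area_pos b_max c_max x_max in
      \<open>simp_all add: det2_def algebra_simps\<close>)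

lemma eta_bounds: "0 \<le> eta" "eta \<le> 1"
  and t_le_1: "t \<le> 1" "barycoord s c a b x \<le> 1"
  and t_sum: "t + barycoord s c a b x = 1 + eta"
proof -
  have "D * barycoord s a b c x = det2 s b (c - b) - det2 s x (c - b)"
    unfolding D_mult by (simp add: det2_def algebra_simps)
  then have "D * barycoord s a b c x \<le> 0"
    using x_max[OF vertices(2)] by simp
  then show "0 \<le> eta"
    using area_pos by (simp add: mult_le_0_iff)
  have "D * t = D + (det2 s x (c - a) - det2 s b (c - a))"
    "D * barycoord s c a b x = D + (det2 s x (a - b) - det2 s c (a - b))"
    unfolding D_mult by (simp_all add: det2_def algebra_simps)
  then have "D * t \<le> D * 1" "D * barycoord s c a b x \<le> D * 1"
    using b_max[OF x_in] c_max[OF x_in] by simp_all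
  then show t: "t \<le> 1" "barycoord s c a b x \<le> 1"
    using area_pos by simp_all
  show "t + barycoord s c a b x = 1 + eta"
    using barycoord_sum[of s b a c x] area_pos by simp
  with t show "eta \<le> 1" by linarith
qed

lemma area_ge: "la + eta \<le> la + 2 / D * measure lebesgue cap"
  using cap_ge area_pos by (simp add: field_simps)

lemma refined_product:
  assumes "21/100 \<le> la" "21/100 \<le> lb" "lb \<le> 456/1000" "21/100 \<le> lc" "lc \<le> 456/1000"
    and eta: "0 < eta" and t: "(1 + eta) / 2 \<le> t" and nontriv: "eta < 1"
  shows "(1 / (1 - lb) + 1 / (1 - lc)) * (1 + eta * (1 - eta) / (9 * (la + eta)))
    \<le> (la + 2 / D * measure lebesgue cap) * (2 * D * measure lebesgue (P \<inter> wedge s bb cc))"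
proof -
  have "eta < t" using t nontriv by (simp add: field_simps)
  from refined_bounds[OF eta this] obtain tau where tau: "0 \<le> tau" "D / 2 * (eta + tau) \<le> measure lebesgue cap"
    "1 / ((1 - lb) * (la + eta)) + (eta / (la + eta) + (t - eta) / (1 - lc)) / (la * t + lb * eta + tau)
       \<le> 2 * D * measure lebesgue (P \<inter> wedge s bb cc)" .
  have "la + lb + lc = 1"
    using barycoord_sum area_pos by simp
  moreover have "la + eta + tau \<le> la + 2 / D * measure lebesgue cap"
    using tau(2) area_pos by (simp add: field_simps)
  ultimately show ?thesis
    using assms tau t_le_1 polar_wedge_ge by (intro refined_product_ge[where tau = tau]) auto
qed

lemma product_gain:
  assumes "21/100 \<le> la" "la \<le> 456/1000" "21/100 \<le> lb" "lb \<le> 456/1000" "21/100 \<le> lc" "lc \<le> 456/1000"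
  shows "(1 / (1 - lb) + 1 / (1 - lc)) * (1 + eta * (1 - eta) / (9 * (la + eta)))
    \<le> (la + 2 / D * measure lebesgue cap) * (2 * D * measure lebesgue (P \<inter> wedge s bb cc))"
proof -
  \<comment> \<open>The coordinates of \<open>x\<close> at \<open>b\<close> and \<open>c\<close> add
    up to \<open>1 + eta\<close>, so one is at least half of it. In the degenerate case no gain is
    claimed.\<close>
  consider "eta * (1 - eta) = 0" | "0 < eta" "eta < 1" "(1 + eta) / 2 \<le> t"
    | "0 < eta" "eta < 1" "(1 + eta) / 2 \<le> barycoord s c a b x"
    using eta_bounds t_sum by fastforce
  then show ?thesis
  proof cases
    case 1
    have "(1 / (1 - lb) + 1 / (1 - lc)) * (1 + eta * (1 - eta) / (9 * (la + eta)))
        = (la + eta) * ((1 / (1 - lb) + 1 / (1 - lc)) / (la + eta))"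
      unfolding 1 using k_pos by simp
    also have "\<dots> \<le> (la + 2 / D * measure lebesgue cap) * (2 * D * measure lebesgue (P \<inter> wedge s bb cc))"
      using k_pos lb_less_1 lc_less_1 area_ge
      by (intro mult_mono[OF area_ge polar_wedge_ge]) (auto intro!: divide_nonneg_pos add_nonneg_nonneg)
    finally show ?thesis .
  next
    case 2
    then show ?thesis using refined_product assms by simp
  next
    case 3
    interpret r: sector K "- s" a c b x by (rule sector_reflect)
    have coords: "barycoord (- s) a c b z = barycoord s a b c z" "barycoord (- s) c b a z = barycoord s c a b z"
      "barycoord (- s) b a c z = barycoord s b c a z" for z
      by (simp_all add: barycoord_uminus_sign)
    have D: "r.D = D"
      by (simp add: det2_uminus_sign)
    have cap: "r.cap = cap"
      by (auto simp: det2_def algebra_simps)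
    have "quarter_turn (- s) (b - a) = quarter_turn s (a - b)"
      "quarter_turn (- s) (a - c) = quarter_turn s (c - a)"
      by (simp_all add: quarter_turn_def vec_eq_iff forall_2 algebra_simps)
    then have wedge: "wedge (- s) r.bb r.cc = wedge s bb cc"
      unfolding coords D by (simp add: wedge_uminus_sign)
    show ?thesis
      using r.refined_product 3 assms unfolding coords D cap wedge[unfolded coords D] by (simp add: add.commute)
  qed
qed

end

section \<open>Decomposing the body and its polar\<close>

lemma measure_three_le:
  fixes S :: "(real ^ 2) set"
  assumes "compact S" "compact U" "compact V" "compact W" "U \<subseteq> S" "V \<subseteq> S" "W \<subseteq> S"
    and "negligible (U \<inter> V)" "negligible (V \<inter> W)" "negligible (W \<inter> U)"
  shows "measure lebesgue U + measure lebesgue V + measure lebesgue W \<le> measure lebesgue S"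
proof -
  have "negligible (U \<inter> (V \<union> W))"
    using assms by (simp add: Int_Un_distrib Int_commute)
  then have "measure lebesgue U + measure lebesgue (V \<union> W) \<le> measure lebesgue S"
    using assms by (intro measure_split_le) auto
  moreover have "measure lebesgue V + measure lebesgue W \<le> measure lebesgue (V \<union> W)"
    using assms by (intro measure_split_le) auto
  ultimately show ?thesis by simp
qed

lemma measure_three_wedges_le:
  assumes "compact P" "p \<noteq> 0" "q \<noteq> 0" "r \<noteq> 0"
  shows "measure lebesgue (P \<inter> wedge 1 p q) + measure lebesgue (P \<inter> wedge 1 q r)
    + measure lebesgue (P \<inter> wedge 1 r p) \<le> measure lebesgue P"
proof (rule measure_three_le)
  have negl: "negligible (P \<inter> wedge 1 u v \<inter> (P \<inter> wedge 1 v w))" if "v \<noteq> 0" for u v w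
  proof (rule negligible_subset)
    show "negligible {z. det2 1 z v = 0}"
      using negligible_det2_line that by simp
    show "P \<inter> wedge 1 u v \<inter> (P \<inter> wedge 1 v w) \<subseteq> {z. det2 1 z v = 0}"
      using det2_commute[of 1 v] by (auto simp: wedge_def)
  qed
  show "negligible (P \<inter> wedge 1 p q \<inter> (P \<inter> wedge 1 q r))"
    "negligible (P \<inter> wedge 1 q r \<inter> (P \<inter> wedge 1 r p))"
    "negligible (P \<inter> wedge 1 r p \<inter> (P \<inter> wedge 1 p q))"
    by (intro negl assms)+
qed (use assms closed_wedge in \<open>auto intro!: compact_Int_closed\<close>)

text \<open>The caps are cut off one after another, leaving \<open>R1\<close>, \<open>R2\<close>,
  \<open>R3\<close>, the last containing the triangle. Since no coordinate exceeds \<open>1\<close>,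
  a point with one nonpositive coordinate has the others nonnegative, so each cap survives the
  earlier cuts.\<close>

lemma measure_caps_le:
  assumes K: "convex K" "compact K" "a \<in> K" "b \<in> K" "c \<in> K"
    and pos: "0 < det2 1 (b - a) (c - a)"
    and le1: "\<And>z. z \<in> K \<Longrightarrow> barycoord 1 a b c z \<le> 1" "\<And>z. z \<in> K \<Longrightarrow> barycoord 1 b c a z \<le> 1"
      "\<And>z. z \<in> K \<Longrightarrow> barycoord 1 c a b z \<le> 1"
  shows "det2 1 (b - a) (c - a) / 2
    + measure lebesgue (K \<inter> {z. det2 1 b (c - b) \<le> det2 1 z (c - b)})
    + measure lebesgue (K \<inter> {z. det2 1 c (a - c) \<le> det2 1 z (a - c)})
    + measure lebesgue (K \<inter> {z. det2 1 a (b - a) \<le> det2 1 z (b - a)}) \<le> measure lebesgue K"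
proof -
  define D where "D = det2 1 (b - a) (c - a)"
  have nz: "c - b \<noteq> 0" "a - c \<noteq> 0" "b - a \<noteq> 0"
    using pos by (auto simp: det2_def)
  note mult = barycoord_mult[of 1 b a c, folded D_def]
  have D: "0 < D" using pos by (simp add: D_def)
  have shift: "det2 1 z (c - b) - det2 1 b (c - b) = - (D * barycoord 1 a b c z)"
    "det2 1 z (a - c) - det2 1 c (a - c) = - (D * barycoord 1 b c a z)"
    "det2 1 z (b - a) - det2 1 a (b - a) = - (D * barycoord 1 c a b z)" for z
    using D by (simp_all add: mult) (simp_all add: det2_def algebra_simps)
  have sign: "D * u \<le> 0 \<longleftrightarrow> u \<le> 0" "0 \<le> D * u \<longleftrightarrow> 0 \<le> u" "D * u = 0 \<longleftrightarrow> u = 0" for u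
    using D by (simp_all add: mult_le_0_iff zero_le_mult_iff)
  have caps: "det2 1 b (c - b) \<le> det2 1 z (c - b) \<longleftrightarrow> barycoord 1 a b c z \<le> 0"
    "det2 1 c (a - c) \<le> det2 1 z (a - c) \<longleftrightarrow> barycoord 1 b c a z \<le> 0"
    "det2 1 a (b - a) \<le> det2 1 z (b - a) \<longleftrightarrow> barycoord 1 c a b z \<le> 0" for z
    using shift[of z] sign by (smt (verit))+
  have comps: "det2 1 b (b - c) \<le> det2 1 z (b - c) \<longleftrightarrow> 0 \<le> barycoord 1 a b c z"
    "det2 1 c (c - a) \<le> det2 1 z (c - a) \<longleftrightarrow> 0 \<le> barycoord 1 b c a z"
    "det2 1 a (a - b) \<le> det2 1 z (a - b) \<longleftrightarrow> 0 \<le> barycoord 1 c a b z" for z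
    using shift[of z] sign unfolding det2_diff by (smt (verit))+
  have lines: "det2 1 z (c - b) = det2 1 b (c - b) \<longleftrightarrow> barycoord 1 a b c z = 0"
    "det2 1 z (a - c) = det2 1 c (a - c) \<longleftrightarrow> barycoord 1 b c a z = 0"
    "det2 1 z (b - a) = det2 1 a (b - a) \<longleftrightarrow> barycoord 1 c a b z = 0" for z
    using shift[of z] sign by (smt (verit))+
  have sum: "barycoord 1 a b c z + barycoord 1 b c a z + barycoord 1 c a b z = 1" for z
    using barycoord_sum pos by simp
  define U1 U2 U3 where "U1 = K \<inter> {z. det2 1 b (c - b) \<le> det2 1 z (c - b)}"
    and "U2 = K \<inter> {z. det2 1 c (a - c) \<le> det2 1 z (a - c)}"
    and "U3 = K \<inter> {z. det2 1 a (b - a) \<le> det2 1 z (b - a)}"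
  define R1 R2 R3 where "R1 = K \<inter> {z. det2 1 b (b - c) \<le> det2 1 z (b - c)}"
    and "R2 = R1 \<inter> {z. det2 1 c (c - a) \<le> det2 1 z (c - a)}"
    and "R3 = R2 \<inter> {z. det2 1 a (a - b) \<le> det2 1 z (a - b)}"
  have U: "compact U1" "compact U2" "compact U3"
    unfolding U1_def U2_def U3_def by (intro compact_Int_closed K closed_det2_halfplane)+
  have R: "compact R1" "compact R2" "compact R3" "convex R3"
    unfolding R1_def R2_def R3_def
    by (intro compact_Int_closed convex_Int K closed_det2_halfplane convex_det2_halfplane)+
  have "U1 \<inter> R1 \<subseteq> {z. det2 1 z (c - b) = det2 1 b (c - b)}"
    "U2 \<inter> R2 \<subseteq> {z. det2 1 z (a - c) = det2 1 c (a - c)}"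
    "U3 \<inter> R3 \<subseteq> {z. det2 1 z (b - a) = det2 1 a (b - a)}"
    unfolding U1_def U2_def U3_def R1_def R2_def R3_def caps comps lines by auto
  moreover have "negligible {z. det2 1 z (c - b) = det2 1 b (c - b)}"
    "negligible {z. det2 1 z (a - c) = det2 1 c (a - c)}" "negligible {z. det2 1 z (b - a) = det2 1 a (b - a)}"
    using nz by (simp_all add: negligible_det2_line)
  ultimately have negl: "negligible (U1 \<inter> R1)" "negligible (U2 \<inter> R2)" "negligible (U3 \<inter> R3)"
    by (blast intro: negligible_subset)+
  have sub: "U2 \<subseteq> R1" "U3 \<subseteq> R2"
    using sum le1 unfolding U1_def U2_def U3_def R1_def R2_def caps comps by (auto; smt (verit))+
  have "measure lebesgue U1 + measure lebesgue R1 \<le> measure lebesgue K"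
    using K U R negl by (intro measure_split_le) (auto simp: U1_def R1_def)
  moreover have "measure lebesgue U2 + measure lebesgue R2 \<le> measure lebesgue R1"
    using U R negl sub by (intro measure_split_le) (auto simp: R2_def)
  moreover have "measure lebesgue U3 + measure lebesgue R3 \<le> measure lebesgue R2"
    using U R negl sub by (intro measure_split_le) (auto simp: R3_def)
  moreover have "a \<in> R3" "b \<in> R3" "c \<in> R3"
    using K D by (auto simp: R1_def R2_def R3_def D_def det2_def algebra_simps)
  then have "D / 2 \<le> measure lebesgue R3"
    unfolding D_def using measure_triangle_le[OF R(4,3), of 1 a b c] by simp
  ultimately show ?thesis
    unfolding U1_def[symmetric] U2_def[symmetric] U3_def[symmetric] D_def[symmetric] by linarith
qed

lemma largest_inscribed_triangle:
  fixes K :: "(real ^ 2) set"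
  assumes "compact K" "0 \<in> interior K"
  obtains a b c where "a \<in> K" "b \<in> K" "c \<in> K" "0 < det2 1 (b - a) (c - a)"
    "\<And>u v w. \<lbrakk>u \<in> K; v \<in> K; w \<in> K\<rbrakk> \<Longrightarrow> det2 1 (v - u) (w - u) \<le> det2 1 (b - a) (c - a)"
proof -
  let ?f = "\<lambda>(u, v, w). det2 1 (v - u) (w - u)"
  have "compact (K \<times> K \<times> K)"
    using assms(1) by (intro compact_Times)
  moreover have K: "0 \<in> K"
    using assms(2) interior_subset by blast
  then have "K \<times> K \<times> K \<noteq> {}" by blast
  moreover have "continuous_on (K \<times> K \<times> K) ?f"
    unfolding case_prod_unfold by (intro continuous_intros)
  ultimately obtain m where m: "m \<in> K \<times> K \<times> K" "\<And>y. y \<in> K \<times> K \<times> K \<Longrightarrow> ?f y \<le> ?f m"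
    using continuous_attains_sup[of "K \<times> K \<times> K" ?f] by blast
  obtain a b c where abc: "m = (a, b, c)" by (cases m)
  \<comment> \<open>Positivity of the maximum needs one nondegenerate triangle \<open>0 w v\<close>;
    \<open>axis 1 1\<close> merely supplies a nonzero \<open>v\<close>.\<close>
  obtain v where v: "v \<in> K" "0 < det2 1 v (axis 1 1)"
    using det2_pos_interior[OF assms(2), of "axis 1 1" 1] by (auto simp: axis_eq_0_iff)
  obtain w where w: "w \<in> K" "0 < det2 1 w v"
    using det2_pos_interior[OF assms(2), of v 1] v by (metis det2_zero(1) less_irrefl zero_neq_one)
  have "0 < ?f (0, w, v)" using w by simp
  also have "\<dots> \<le> ?f m" using m(2)[of "(0, w, v)"] K v w by simp
  finally have "0 < det2 1 (b - a) (c - a)" by (simp add: abc)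
  then show ?thesis
    using that[of a b c] m unfolding abc by auto
qed

text \<open>The triangle \<open>u v w\<close> is the image of \<open>a b c\<close> under the
  homothety about the centroid with ratio \<open>1 - 3 * m\<close>; for \<open>m = 1\<close> it is
  the anticomplementary triangle. A coordinate \<open>l\<close> becomes
  \<open>(m - l) / (3 * m - 1)\<close>, so \<open>l \<le> 1\<close> bounds each defect.\<close>

lemma banach_mazur_distance_le_inner_triangle:
  fixes K T :: "(real ^ 2) set"
  assumes T: "2 simplex T" and K: "convex K" "a \<in> K" "b \<in> K" "c \<in> K"
    and pos: "0 < det2 1 (b - a) (c - a)"
    and le1: "\<And>z. z \<in> K \<Longrightarrow> barycoord 1 a b c z \<le> 1" "\<And>z. z \<in> K \<Longrightarrow> barycoord 1 b c a z \<le> 1"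
      "\<And>z. z \<in> K \<Longrightarrow> barycoord 1 c a b z \<le> 1"
    and xyz: "x \<in> K" "y \<in> K" "z \<in> K"
    and m: "78/100 \<le> m" "m \<le> - barycoord 1 a b c x" "m \<le> - barycoord 1 b c a y" "m \<le> - barycoord 1 c a b z"
  shows "banach_mazur_distance K T \<le> 1 + 3 * (1 - m) / (3 * m - 1)"
proof -
  have vertex: "(1 - 2 * m) *\<^sub>R a + m *\<^sub>R b + m *\<^sub>R c \<in> K"
    if K: "a \<in> K" "b \<in> K" "c \<in> K" and pos: "0 < det2 1 (b - a) (c - a)"
      and le1: "\<And>z. z \<in> K \<Longrightarrow> barycoord 1 b c a z \<le> 1" "\<And>z. z \<in> K \<Longrightarrow> barycoord 1 c a b z \<le> 1"
      and x: "x \<in> K" "m \<le> - barycoord 1 a b c x" for a b c x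
  proof -
    \<comment> \<open>The vertex is found in the triangle \<open>x b c\<close>. The weight
      \<open>p\<close> of \<open>x\<close> is chosen to give \<open>a\<close> the coefficient
      \<open>1 - 2 * m\<close>; the other weights are nonnegative because
      \<open>p \<le> m\<close>.\<close>
    define e p where "e = - barycoord 1 a b c x" and "p = (2 * m - 1) / e"
    have e: "m \<le> e" using x by (simp add: e_def)
    have p: "0 \<le> p" "p * e = 2 * m - 1" using e m by (simp_all add: p_def)
    have "p \<le> (2 * m - 1) / m" unfolding p_def using e m by (intro divide_left_mono) auto
    also have "\<dots> \<le> m" using m zero_le_power2[of "m - 1"]
      by (simp add: pos_divide_le_eq power2_eq_square algebra_simps)
    finally have pm: "p \<le> m" .
    have sum: "barycoord 1 b c a x + barycoord 1 c a b x = 1 + e"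
      using barycoord_sum[of 1 b a c x] pos by (simp add: e_def)
    have le: "p * barycoord 1 b c a x \<le> m" "p * barycoord 1 c a b x \<le> m"
      using mult_left_mono[OF le1(1)[OF x(1)] p(1)] mult_left_mono[OF le1(2)[OF x(1)] p(1)] pm by simp_all
    have "convex hull {x, b, c} \<subseteq> K"
      using K x \<open>convex K\<close> by (intro hull_minimal) auto
    moreover have "p *\<^sub>R x + (m - p * barycoord 1 b c a x) *\<^sub>R b + (m - p * barycoord 1 c a b x) *\<^sub>R c
        \<in> convex hull {x, b, c}"
    proof -
      have "p + (m - p * barycoord 1 b c a x) + (m - p * barycoord 1 c a b x)
          = p + 2 * m - p * (barycoord 1 b c a x + barycoord 1 c a b x)"
        by (simp add: algebra_simps)
      also have "\<dots> = 1" unfolding sum using p(2) by (simp add: algebra_simps)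
      finally have "p + (m - p * barycoord 1 b c a x) + (m - p * barycoord 1 c a b x) = 1" .
      then show ?thesis
        unfolding convex_hull_3 using p le by force
    qed
    moreover have "p *\<^sub>R x + (m - p * barycoord 1 b c a x) *\<^sub>R b + (m - p * barycoord 1 c a b x) *\<^sub>R c
        = (1 - 2 * m) *\<^sub>R a + m *\<^sub>R b + m *\<^sub>R c"
    proof -
      have "p *\<^sub>R x = (- (p * e)) *\<^sub>R a + (p * barycoord 1 b c a x) *\<^sub>R b + (p * barycoord 1 c a b x) *\<^sub>R c"
        using arg_cong[OF barycoord_expansion[of 1 b a c x], of "\<lambda>v. p *\<^sub>R v"] pos
        by (simp add: e_def scaleR_add_right)
      then show ?thesis unfolding p(2) by (simp add: algebra_simps)
    qed
    ultimately show ?thesis by auto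
  qed
  define u v w where "u = (1 - 2 * m) *\<^sub>R a + m *\<^sub>R b + m *\<^sub>R c"
    and "v = (1 - 2 * m) *\<^sub>R b + m *\<^sub>R c + m *\<^sub>R a" and "w = (1 - 2 * m) *\<^sub>R c + m *\<^sub>R a + m *\<^sub>R b"
  have uvw: "u \<in> K" "v \<in> K" "w \<in> K"
    unfolding u_def v_def w_def using det2_cyclic[of 1 c b a] pos K xyz m
    by (intro vertex[OF _ _ _ _ le1(2,3)] vertex[OF _ _ _ _ le1(3,1)] vertex[OF _ _ _ _ le1(1,2)]; simp)+
  have det: "det2 1 (v - u) (w - u) = (3 * m - 1)\<^sup>2 * det2 1 (b - a) (c - a)"
    by (simp add: u_def v_def w_def det2_def power2_eq_square algebra_simps)
  have coords: "- ((1 - m) / (3 * m - 1)) \<le> det2 1 (q - z) (r - z) / ((3 * m - 1)\<^sup>2 * det2 1 (b - a) (c - a))"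
    if "l \<le> 1" "det2 1 (q - z) (r - z) = (3 * m - 1) * (m - l) * det2 1 (b - a) (c - a)"
    for q r z l
  proof -
    have "det2 1 (q - z) (r - z) / ((3 * m - 1)\<^sup>2 * det2 1 (b - a) (c - a)) = (m - l) / (3 * m - 1)"
      unfolding that(2) using pos m by (simp add: power2_eq_square)
    also have "\<dots> \<ge> (m - 1) / (3 * m - 1)" using that m by (intro divide_right_mono) auto
    finally show ?thesis by (simp add: minus_divide_left)
  qed
  note mult = barycoord_mult[of 1 b a c, OF less_imp_neq[OF pos, symmetric]]
  have "banach_mazur_distance K T \<le> 1 + ((1 - m) / (3 * m - 1) + (1 - m) / (3 * m - 1) + (1 - m) / (3 * m - 1))"
  proof (rule banach_mazur_distance_triangle_le(1)[OF T K(1) uvw])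
    show "det2 1 (v - u) (w - u) \<noteq> 0" unfolding det using pos m by simp
    have "m \<le> 1"
      using m(2) barycoord_sum[of 1 b a c x] pos le1(2,3)[OF xyz(1)] by simp
    then show "0 \<le> (1 - m) / (3 * m - 1)" "0 \<le> (1 - m) / (3 * m - 1)" "0 \<le> (1 - m) / (3 * m - 1)"
      using m by simp_all
  next
    fix z assume z: "z \<in> K"
    have eq: "det2 1 (v - z) (w - z) = (3 * m - 1) * (m - barycoord 1 a b c z) * det2 1 (b - a) (c - a)"
      "det2 1 (w - z) (u - z) = (3 * m - 1) * (m - barycoord 1 b c a z) * det2 1 (b - a) (c - a)"
      "det2 1 (u - z) (v - z) = (3 * m - 1) * (m - barycoord 1 c a b z) * det2 1 (b - a) (c - a)"
    proof -
      have *: "(3 * m - 1) * (m - l) * D = (3 * m - 1) * (m * D - D * l)" for l D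
        by (simp add: algebra_simps)
      show "det2 1 (v - z) (w - z) = (3 * m - 1) * (m - barycoord 1 a b c z) * det2 1 (b - a) (c - a)"
        "det2 1 (w - z) (u - z) = (3 * m - 1) * (m - barycoord 1 b c a z) * det2 1 (b - a) (c - a)"
        "det2 1 (u - z) (v - z) = (3 * m - 1) * (m - barycoord 1 c a b z) * det2 1 (b - a) (c - a)"
        unfolding * mult by (simp_all add: u_def v_def w_def det2_def algebra_simps)
    qed
    show "- ((1 - m) / (3 * m - 1)) \<le> barycoord 1 u v w z" "- ((1 - m) / (3 * m - 1)) \<le> barycoord 1 v w u z"
      "- ((1 - m) / (3 * m - 1)) \<le> barycoord 1 w u v z"
      unfolding barycoord_def[of _ u] barycoord_def[of _ v] barycoord_def[of _ w] det2_cyclic[of 1 w v u]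
        det2_cyclic(2)[of 1 u w v] det
      using coords[OF le1(1)[OF z] eq(1)] coords[OF le1(2)[OF z] eq(2)] coords[OF le1(3)[OF z] eq(3)]
      by auto
  qed
  then show ?thesis by (simp add: add_divide_distrib[symmetric])
qed

theorem volume_product_stability:
  fixes K T :: "(real ^ 2) set"
  assumes K: "convex K" "compact K" "0 \<in> interior K" and T: "2 simplex T"
  shows "27 * (1 + (banach_mazur_distance K T - 1) / 900)
    \<le> 4 * (measure lebesgue K * measure lebesgue (polar_body K))"
    and "1 \<le> banach_mazur_distance K T"
proof -
  obtain a b c where abc: "a \<in> K" "b \<in> K" "c \<in> K" and pos: "0 < det2 1 (b - a) (c - a)"
    and max: "\<And>u v w. \<lbrakk>u \<in> K; v \<in> K; w \<in> K\<rbrakk> \<Longrightarrow> det2 1 (v - u) (w - u) \<le> det2 1 (b - a) (c - a)"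
    using largest_inscribed_triangle[OF K(2,3)] by blast
  define D where "D = det2 1 (b - a) (c - a)"
  have D: "0 < D" "det2 1 (b - a) (c - a) = D" "det2 1 (c - b) (a - b) = D" "det2 1 (a - c) (b - c) = D"
    using pos det2_cyclic[of 1 c b a] by (simp_all add: D_def)
  have "\<exists>x\<in>K. \<forall>z\<in>K. det2 1 z w \<le> det2 1 x w" for w
    using abc K by (intro continuous_attains_sup continuous_intros) auto
  then obtain x y z where xyz: "x \<in> K" "y \<in> K" "z \<in> K"
    and far: "\<And>u. u \<in> K \<Longrightarrow> det2 1 u (c - b) \<le> det2 1 x (c - b)"
      "\<And>u. u \<in> K \<Longrightarrow> det2 1 u (a - c) \<le> det2 1 y (a - c)"
      "\<And>u. u \<in> K \<Longrightarrow> det2 1 u (b - a) \<le> det2 1 z (b - a)"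
    by metis
  \<comment> \<open>Moving one vertex of a largest triangle cannot increase its area, so
    \<open>K\<close> stays within the lines through the vertices parallel to the opposite
    sides.\<close>
  have support: "det2 1 u (c - b) \<ge> det2 1 a (c - b)" "det2 1 u (a - c) \<ge> det2 1 b (a - c)"
    "det2 1 u (b - a) \<ge> det2 1 c (b - a)" if "u \<in> K" for u
    using max[OF that abc(2,3)] max[OF abc(1) that abc(3)] max[OF abc(1,2) that]
    by (simp_all add: det2_def algebra_simps)
  have support': "det2 1 u (b - c) \<le> det2 1 a (b - c)" "det2 1 u (c - a) \<le> det2 1 b (c - a)"
    "det2 1 u (a - b) \<le> det2 1 c (a - b)" if "u \<in> K" for u
    using support[OF that] by (simp_all add: det2_diff)
  interpret s1: sector K 1 a b c x
    using K abc xyz far support' D by unfold_locales auto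
  interpret s2: sector K 1 b c a y
    using K abc xyz far support' D by unfold_locales auto
  interpret s3: sector K 1 c a b z
    using K abc xyz far support' D by unfold_locales auto
  define l1 l2 l3 where "l1 = barycoord 1 a b c 0" and "l2 = barycoord 1 b c a 0" and "l3 = barycoord 1 c a b 0"
  define e1 e2 e3 where "e1 = - barycoord 1 a b c x" and "e2 = - barycoord 1 b c a y" and "e3 = - barycoord 1 c a b z"
  \<comment> \<open>In units of \<open>D / 2\<close>: the signed area of the triangle from the
    origin over a side plus the area of the cap beyond it. The signed parts add up to
    \<open>1\<close>.\<close>
  define A1 A2 A3 where "A1 = l1 + 2 / D * measure lebesgue s1.cap"
    and "A2 = l2 + 2 / D * measure lebesgue s2.cap" and "A3 = l3 + 2 / D * measure lebesgue s3.cap"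
  define p1 p2 p3 where "p1 = (1 / (D * (1 - l1))) *\<^sub>R quarter_turn 1 (b - c)"
    and "p2 = (1 / (D * (1 - l2))) *\<^sub>R quarter_turn 1 (c - a)"
    and "p3 = (1 / (D * (1 - l3))) *\<^sub>R quarter_turn 1 (a - b)"
  note defs = l1_def[symmetric] l2_def[symmetric] l3_def[symmetric] e1_def[symmetric] e2_def[symmetric] e3_def[symmetric]
  \<comment> \<open>The polar areas in units making the product scale free. The wedge paired with a
    side is bounded by the duals of the lines through its end points.\<close>
  define C1 C2 C3 where "C1 = 2 * D * measure lebesgue (polar_body K \<inter> wedge 1 p2 p3)"
    and "C2 = 2 * D * measure lebesgue (polar_body K \<inter> wedge 1 p3 p1)"
    and "C3 = 2 * D * measure lebesgue (polar_body K \<inter> wedge 1 p1 p2)"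

  have coord_le1: "barycoord 1 a b c u \<le> 1" "barycoord 1 b c a u \<le> 1" "barycoord 1 c a b u \<le> 1"
    if "u \<in> K" for u
  proof -
    show "barycoord 1 a b c u \<le> 1"
      using max[OF that abc(2,3)] pos by (simp add: barycoord_def)
    show "barycoord 1 b c a u \<le> 1"
      using max[OF that abc(3,1)] D by (simp add: barycoord_def)
    show "barycoord 1 c a b u \<le> 1"
      using max[OF that abc(1,2)] D by (simp add: barycoord_def)
  qed
  have coord_ge: "- e1 \<le> barycoord 1 a b c u" "- e2 \<le> barycoord 1 b c a u" "- e3 \<le> barycoord 1 c a b u"
    if "u \<in> K" for u
  proof -
    have mono: "barycoord 1 p q r v \<le> barycoord 1 p q r u"
      if "0 < det2 1 (q - p) (r - p)" "det2 1 u (r - q) \<le> det2 1 v (r - q)" for p q r v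
      unfolding barycoord_def using that
      by (intro divide_right_mono) (auto simp: det2_def algebra_simps)
    show "- e1 \<le> barycoord 1 a b c u" "- e2 \<le> barycoord 1 b c a u" "- e3 \<le> barycoord 1 c a b u"
      unfolding e1_def e2_def e3_def minus_minus using D far[OF that] by (intro mono; simp)+
  qed
  have e: "0 \<le> e1" "e1 \<le> 1" "0 \<le> e2" "e2 \<le> 1" "0 \<le> e3" "e3 \<le> 1"
    using s1.eta_bounds s2.eta_bounds s3.eta_bounds by (simp_all add: e1_def e2_def e3_def)
  have nz: "det2 1 (b - a) (c - a) \<noteq> 0" using pos by simp
  have upper: "banach_mazur_distance K T \<le> 1 + (e1 + e2 + e3)"
    by (rule banach_mazur_distance_triangle_le(1)[OF T K(1) abc nz e(1,3,5) coord_ge])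
  have "\<exists>t\<ge>1. \<exists>A x. invertible_affine_map A \<and> T \<subseteq> A ` K \<and> A ` K \<subseteq> (\<lambda>z. t *\<^sub>R z + x) ` T"
    by (rule banach_mazur_distance_triangle_le(2)[OF T K(1) abc nz e(1,3,5) coord_ge])
  then show "1 \<le> banach_mazur_distance K T"
    unfolding banach_mazur_distance_def by (intro cInf_greatest) auto

  have sum_l: "l1 + l2 + l3 = 1"
    unfolding l1_def l2_def l3_def by (rule barycoord_sum[OF nz])
  have "27 * (1 + (banach_mazur_distance K T - 1) / 900) \<le> (A1 + A2 + A3) * (C1 + C2 + C3)"
  proof (rule product_of_sums_ge[where ?l1.0 = l1 and ?l2.0 = l2 and ?l3.0 = l3 and ?e1.0 = e1 and ?e2.0 = e2 and ?e3.0 = e3])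
    show "l1 < 1" "l2 < 1" "l3 < 1"
      using s1.lb_less_1 s1.lc_less_1 s2.lc_less_1 by (simp_all add: defs)
    show "0 < l1 + e1" "0 < l2 + e2" "0 < l3 + e3"
      using s1.k_pos s2.k_pos s3.k_pos unfolding defs by simp_all
    show "l1 + e1 \<le> A1" "l2 + e2 \<le> A2" "l3 + e3 \<le> A3"
      using s1.area_ge s2.area_ge s3.area_ge unfolding defs D A1_def A2_def A3_def by simp_all
    show "(1 / (1 - l2) + 1 / (1 - l3)) / (l1 + e1) \<le> C1"
      "(1 / (1 - l3) + 1 / (1 - l1)) / (l2 + e2) \<le> C2"
      "(1 / (1 - l1) + 1 / (1 - l2)) / (l3 + e3) \<le> C3"
      using s1.polar_wedge_ge s2.polar_wedge_ge s3.polar_wedge_ge unfolding D defs C1_def C2_def C3_def p1_def p2_def p3_def by blast+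
    show "(1 / (1 - l2) + 1 / (1 - l3)) * (1 + e1 * (1 - e1) / (9 * (l1 + e1))) \<le> A1 * C1
      \<and> (1 / (1 - l3) + 1 / (1 - l1)) * (1 + e2 * (1 - e2) / (9 * (l2 + e2))) \<le> A2 * C2
      \<and> (1 / (1 - l1) + 1 / (1 - l2)) * (1 + e3 * (1 - e3) / (9 * (l3 + e3))) \<le> A3 * C3"
      if "21/100 \<le> l1" "l1 \<le> 456/1000" "21/100 \<le> l2" "l2 \<le> 456/1000" "21/100 \<le> l3" "l3 \<le> 456/1000"
      using s1.product_gain s2.product_gain s3.product_gain that
      unfolding D defs A1_def A2_def A3_def C1_def C2_def C3_def p1_def p2_def p3_def by blast
    show "banach_mazur_distance K T - 1 \<le> 3 * (1 - m) / (3 * m - 1)"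
      if "78/100 \<le> m" "m \<le> e1" "m \<le> e2" "m \<le> e3" for m
      using banach_mazur_distance_le_inner_triangle[OF T K(1) abc pos coord_le1 xyz that(1)] that
      unfolding e1_def e2_def e3_def by simp
  qed (use sum_l e upper in simp_all)
  also have "\<dots> \<le> (2 / D * measure lebesgue K) * (2 * D * measure lebesgue (polar_body K))"
  proof (rule mult_mono)
    have "D / 2 * (A1 + A2 + A3) = D / 2 * (l1 + l2 + l3)
        + measure lebesgue s1.cap + measure lebesgue s2.cap + measure lebesgue s3.cap"
      using D(1) by (simp add: A1_def A2_def A3_def distrib_left)
    also have "\<dots> \<le> measure lebesgue K"
      unfolding sum_l using measure_caps_le[OF K(1,2) abc pos coord_le1] by (simp add: D_def)
    finally show "A1 + A2 + A3 \<le> 2 / D * measure lebesgue K"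
      using D(1) by (simp add: field_simps)
    have "p1 \<noteq> 0" "p2 \<noteq> 0" "p3 \<noteq> 0"
      using s1.lb_less_1 s1.lc_less_1 s2.lc_less_1 D s1.distinct s2.distinct unfolding defs
      by (simp_all add: p1_def p2_def p3_def quarter_turn_eq_0)
    then have "measure lebesgue (polar_body K \<inter> wedge 1 p1 p2) + measure lebesgue (polar_body K \<inter> wedge 1 p2 p3)
        + measure lebesgue (polar_body K \<inter> wedge 1 p3 p1) \<le> measure lebesgue (polar_body K)"
      by (intro measure_three_wedges_le compact_polar_body K)
    then show "C1 + C2 + C3 \<le> 2 * D * measure lebesgue (polar_body K)"
      unfolding C1_def C2_def C3_def distrib_left[symmetric] using D(1)
      by (intro mult_left_mono) auto
    show "0 \<le> 2 / D * measure lebesgue K" "0 \<le> C1 + C2 + C3"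
      using D(1) by (simp_all add: C1_def C2_def C3_def)
  qed
  also have "\<dots> = 4 * (measure lebesgue K * measure lebesgue (polar_body K))"
    using D(1) by simp
  finally show "27 * (1 + (banach_mazur_distance K T - 1) / 900)
    \<le> 4 * (measure lebesgue K * measure lebesgue (polar_body K))" .
qed

section \<open>The superdifferential\<close>

text \<open>For the slope \<open>q = - u x0 * p\<close>, a maximiser of
  \<open>u x - q \<bullet> x\<close> in the interior has \<open>q\<close> as a supergradient; such a
  maximiser always exists.\<close>

lemma polar_subset_superdifferential_image:
  fixes \<Omega> :: "'a::euclidean_space set"
  assumes "compact \<Omega>" "continuous_on \<Omega> u" and frontier: "\<And>x. x \<in> frontier \<Omega> \<Longrightarrow> u x = 0"
    and x0: "x0 \<in> \<Omega>" "0 < u x0"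
  shows "(\<lambda>p. (- u x0) *\<^sub>R p) ` polar_body ((\<lambda>z. z - x0) ` \<Omega>) \<subseteq> superdifferential_image \<Omega> u"
proof (intro image_subsetI)
  fix p assume p: "p \<in> polar_body ((\<lambda>z. z - x0) ` \<Omega>)"
  define q where "q = (- u x0) *\<^sub>R p"
  have int: "y \<in> interior \<Omega>" if "y \<in> \<Omega>" "u y \<noteq> 0" for y
    using that frontier[of y] assms(1) by (auto simp: frontier_def compact_imp_closed)
  have "\<exists>y\<in>\<Omega>. \<forall>x\<in>\<Omega>. u x - q \<bullet> x \<le> u y - q \<bullet> y"
    using assms by (intro continuous_attains_sup continuous_intros) auto
  then obtain y where y: "y \<in> \<Omega>" "\<And>x. x \<in> \<Omega> \<Longrightarrow> u x - q \<bullet> x \<le> u y - q \<bullet> y"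
    by blast
  \<comment> \<open>Where \<open>u\<close> is nonzero the point is interior. If
    \<open>u y = 0\<close>, the polar inequality at \<open>y\<close> shows that \<open>x0\<close>
    does at least as well.\<close>
  have "\<exists>y\<in>interior \<Omega>. \<forall>x\<in>\<Omega>. u x - q \<bullet> x \<le> u y - q \<bullet> y"
  proof (cases "u y = 0")
    case True
    have "p \<bullet> (y - x0) \<le> 1" using p y by (auto simp: polar_body_def)
    then have "u x0 * (p \<bullet> (y - x0)) \<le> u x0 * 1"
      using x0 by (intro mult_left_mono) auto
    then have "u y - q \<bullet> y \<le> u x0 - q \<bullet> x0"
      using True by (simp add: q_def inner_diff_right algebra_simps)
    then show ?thesis
      using y(2) int[OF x0(1)] x0(2) by (intro bexI[of _ x0]) (auto intro: order_trans)
  qed (use y int in blast)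
  then show "(- u x0) *\<^sub>R p \<in> superdifferential_image \<Omega> u"
    unfolding q_def[symmetric] superdifferential_image_def superdifferential_def
    by (force simp: inner_diff_right)
qed

theorem theorem4p5:
  fixes \<Omega> T :: "(real ^ 2) set" and u :: "real ^ 2 \<Rightarrow> real"
  assumes "convex_body \<Omega>"
    and "0 \<in> interior \<Omega>"
    and "continuous_on \<Omega> u"
    and "concave_on \<Omega> u"
    and "\<forall>x\<in>frontier \<Omega>. u x = 0"
    and "0 < emeasure lebesgue (superdifferential_image \<Omega> u)"
    and "emeasure lebesgue (superdifferential_image \<Omega> u) < \<infinity>"
    and "2 simplex T"
  shows "(4 / 27 * measure lebesgue \<Omega> * measure lebesgue (superdifferential_image \<Omega> u)
            - (SUP x\<in>\<Omega>. u x)\<^sup>2)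
          / (4 / 27 * measure lebesgue \<Omega> * measure lebesgue (superdifferential_image \<Omega> u))
         \<ge> (banach_mazur_distance \<Omega> T - 1) / (banach_mazur_distance \<Omega> T + 899)"
proof -
  define d where "d = banach_mazur_distance \<Omega> T"
  define W where "W = measure lebesgue \<Omega>"
  define M where "M = measure lebesgue (superdifferential_image \<Omega> u)"
  have \<Omega>: "convex \<Omega>" "compact \<Omega>" "\<Omega> \<noteq> {}"
    using assms(1) by (auto simp: convex_body_def)
  have d: "1 \<le> d" and "27 * (1 + (d - 1) / 900) \<le> 4 * (W * measure lebesgue (polar_body \<Omega>))"
    using volume_product_stability[OF \<Omega>(1,2) assms(2,8)] by (simp_all add: d_def W_def)
  moreover from d have "0 < 27 * (1 + (d - 1) / 900)" by (simp add: add_pos_nonneg)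
  ultimately have "0 < W * measure lebesgue (polar_body \<Omega>)" by linarith
  then have W: "0 < W" by (simp add: W_def zero_less_mult_iff)
  \<comment> \<open>A set that is not measurable has \<open>emeasure\<close> zero by convention, so
    positivity yields measurability.\<close>
  have image: "superdifferential_image \<Omega> u \<in> lmeasurable"
    using assms(6,7) by (intro fmeasurableI) (auto intro: ccontr simp: emeasure_notin_sets)
  then have M: "0 < M"
    using assms(6) by (simp add: M_def emeasure_eq_measure2)
  obtain x0 where x0: "x0 \<in> \<Omega>" "\<And>x. x \<in> \<Omega> \<Longrightarrow> u x \<le> u x0"
    using continuous_attains_sup[OF \<Omega>(2,3) assms(3)] by blast
  then have sup: "(SUP x\<in>\<Omega>. u x) = u x0"
    by (intro cSup_eq_maximum) auto
  have "frontier \<Omega> \<noteq> {}"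
    using \<Omega> by (metis compact_imp_bounded frontier_eq_empty not_bounded_UNIV)
  then obtain z where "z \<in> frontier \<Omega>" by blast
  then have "0 \<le> u x0"
    using x0(2)[of z] assms(5) \<Omega>(2) frontier_subset_compact by fastforce
  \<comment> \<open>The claim without denominators, using
    \<open>1 + (d - 1) / 900 = (d + 899) / 900\<close>.\<close>
  have key: "(u x0)\<^sup>2 * (d + 899) \<le> 900 * (4 / 27 * W * M)"
  proof (cases "u x0 = 0")
    case True
    then show ?thesis using W M by simp
  next
    case False
    then have pos: "0 < u x0" using \<open>0 \<le> u x0\<close> by simp
    \<comment> \<open>The polar is taken about a maximum point, which is interior because
      \<open>u\<close> vanishes on the frontier.\<close>
    define K where "K = (\<lambda>z. z - x0) ` \<Omega>"
    have x0_int: "x0 \<in> interior \<Omega>"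
      using x0(1) False assms(5) \<Omega>(2) by (auto simp: frontier_def compact_imp_closed)
    have K: "convex K" "compact K" "0 \<in> interior K"
      using \<Omega> x0_int
      by (auto simp: K_def convex_translation_subtract compact_translation_subtract interior_translation_subtract)
    have "measure lebesgue K = W"
      by (simp add: K_def W_def measure_translation_subtract)
    then have "27 * (1 + (d - 1) / 900) \<le> 4 * (W * measure lebesgue (polar_body K))"
      using volume_product_stability(1)[OF K assms(8)]
      by (simp add: d_def K_def banach_mazur_distance_translation)
    moreover have "(u x0)\<^sup>2 * measure lebesgue (polar_body K) \<le> M"
    proof -
      have "(u x0)\<^sup>2 * measure lebesgue (polar_body K) = measure lebesgue ((\<lambda>p. (- u x0) *\<^sub>R p) ` polar_body K)"
        using measure_lebesgue_affine[of "- u x0" 0 "polar_body K"] by simp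
      also have "\<dots> \<le> M"
        unfolding M_def K_def
        using polar_subset_superdifferential_image[OF \<Omega>(2) assms(3) _ x0(1) pos] assms(5) image
          compact_scaling[OF compact_polar_body[OF K(3)], of "- u x0"]
        by (intro measure_mono_fmeasurable) (auto simp: K_def lmeasurable_compact fmeasurableD)
      finally show ?thesis .
    qed
    then have "4 * W * ((u x0)\<^sup>2 * measure lebesgue (polar_body K)) \<le> 4 * W * M"
      using W by (intro mult_left_mono) auto
    moreover have "(u x0)\<^sup>2 * (27 * (1 + (d - 1) / 900)) \<le> (u x0)\<^sup>2 * (4 * (W * measure lebesgue (polar_body K)))"
      by (intro mult_left_mono calculation) auto
    ultimately have "(u x0)\<^sup>2 * (27 * (1 + (d - 1) / 900)) \<le> 4 * W * M"
      by (simp add: mult_ac)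
    then show ?thesis by (simp add: field_simps)
  qed
  have X: "0 < 4 / 27 * W * M" using W M by simp
  have "(u x0)\<^sup>2 / (4 / 27 * W * M) \<le> 900 / (d + 899)"
    using key X d by (simp add: divide_simps mult_ac)
  moreover have "(d - 1) / (d + 899) = 1 - 900 / (d + 899)"
    using d by (simp add: field_simps)
  moreover have "(4 / 27 * W * M - (u x0)\<^sup>2) / (4 / 27 * W * M) = 1 - (u x0)\<^sup>2 / (4 / 27 * W * M)"
    using W M by (simp add: diff_divide_distrib)
  ultimately show ?thesis
    unfolding sup W_def[symmetric] M_def[symmetric] d_def[symmetric] by linarith
qed

end
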